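(* The map $\pi_n:M_\Omega(n,\mathfrak e)\to M_\Omega(n)$ defines $M_\Omega(n,\mathfrak e)$ as an analytic covering of $M_\Omega(n)$ with $\Sigma_n$ as the group of deck transformations.
   Context: Fix a positive integer $n$; $I_k=\{1,\dots,k\}$, $d(k)=k(k+1)/2$. $M(n)$ is the space of complex $n\times n$ matrices; for $x\in M(n)$ and $m\in I_n$, $x_m$ is the upper left $m\times m$ block of $x$. $M_\Omega(n)$ is the Zariski open set of all $x\in M(n)$ such that $x_m$ has $m$ distinct eigenvalues for every $m\in I_n$, and $x_m,x_{m+1}$ have no common eigenvalue for every $m\in I_{n-1}$. $\mathfrak e_{\Omega(n)}$ is the set of all $\nu=(\nu(1),\dots,\nu(n))$, $\nu(m)=\mathrm{diag}(\nu_{1\,m},\dots,\nu_{m\,m})$, such that for each $m\in I_n$ the numbers $\nu_{1\,m},\dots,\nu_{m\,m}$ are distinct and $\nu_{i\,m}\ne\nu_{j\,m+1}$ for all $m\in I_{n-1}$, $i\in I_m$, $j\in I_{m+1}$; it is a Zariski open subset of $\mathbb C^{d(n)}$. Let $$M_\Omega(n,\mathfrak e)=\{(\nu,x)\in\mathfrak e_{\Omega(n)}\times M_\Omega(n)\mid \nu(m)\text{ is } Gl(m)\text{-conjugate to }x_m\ \forall m\in I_n\},$$ with $\pi_n(\nu,x)=x$; it is a nonsingular affine variety of dimension $n^2$, hence a complex manifold. The group $\Sigma_n=S_1\times\cdots\times S_n$ (product of symmetric groups) acts on it by $\sigma\cdot(\nu,x)=(\sigma\cdot\nu,x)$, $(\sigma\cdot\nu)_{i\,m}=\nu_{\sigma_m^{-1}(i)\,m}$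 for $\sigma=(\sigma_1,\dots,\sigma_n)$. *)

theory Defs
  imports
    "HOL-Complex_Analysis.Complex_Analysis"
    "HOL-Algebra.Bij"
    "HOL-Algebra.Sym_Groups"
    "HOL-Algebra.Product_Groups"
    "Jordan_Normal_Form.Spectral_Radius"
begin

section \<open>Holomorphic maps between subsets of affine spaces\<close>

text \<open>
  For a finite index set \<open>I\<close>, the space \<open>\<complex>\<^sup>I\<close> is realised as the set of functions vanishing
  off \<open>I\<close>, with the topology induced from the product topology on functions. The product
  \<open>\<complex>\<^sup>I \<times> \<complex>\<^sup>J\<close> is then \<open>\<complex>\<^sup>I\<^sup>+\<^sup>J\<close>, the pair \<open>(u, v)\<close> being the function \<open>case_sum u v\<close>.
\<close>

definition cspace :: "'i set \<Rightarrow> ('i \<Rightarrow> complex) set" where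
  "cspace I = {z. \<forall>i. i \<notin> I \<longrightarrow> z i = 0}"

text \<open>
  Holomorphic functions on an open subset of \<open>\<complex>\<^sup>I\<close>: continuous, and holomorphic in each
  variable separately (equivalently, by Osgood's lemma, locally given by convergent power series).
\<close>

definition holo_fun :: "'i set \<Rightarrow> ('i \<Rightarrow> complex) set \<Rightarrow> (('i \<Rightarrow> complex) \<Rightarrow> complex) \<Rightarrow> bool" where
  "holo_fun I W F \<longleftrightarrow>
     openin (top_of_set (cspace I)) W \<and> continuous_on W F \<and>
     (\<forall>z\<in>W. \<forall>i\<in>I. (\<lambda>w. F (z(i := w))) holomorphic_on {w. z(i := w) \<in> W})"

text \<open>
  A map \<open>f\<close> from \<open>X \<subseteq> \<complex>\<^sup>I\<close> to \<open>Y \<subseteq> \<complex>\<^sup>J\<close> is holomorphic if its components are locally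
  restrictions of holomorphic functions on open sets of \<open>\<complex>\<^sup>I\<close>. For a complex submanifold
  (in particular a nonsingular subvariety) \<open>X\<close> this is holomorphy for the
  manifold structure of \<open>X\<close>.
\<close>

definition holo_map ::
  "'i set \<Rightarrow> 'j set \<Rightarrow> ('i \<Rightarrow> complex) set \<Rightarrow> ('j \<Rightarrow> complex) set \<Rightarrow>
   (('i \<Rightarrow> complex) \<Rightarrow> ('j \<Rightarrow> complex)) \<Rightarrow> bool" where
  "holo_map I J X Y f \<longleftrightarrow>
     X \<subseteq> cspace I \<and> Y \<subseteq> cspace J \<and> f ` X \<subseteq> Y \<and>
     (\<forall>j\<in>J. \<forall>a\<in>X. \<exists>W F. a \<in> W \<and> holo_fun I W F \<and> (\<forall>z\<in>X \<inter> W. f z j = F z))"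

definition biholomorphism ::
  "'i set \<Rightarrow> 'j set \<Rightarrow> ('i \<Rightarrow> complex) set \<Rightarrow> ('j \<Rightarrow> complex) set \<Rightarrow>
   (('i \<Rightarrow> complex) \<Rightarrow> ('j \<Rightarrow> complex)) \<Rightarrow> (('j \<Rightarrow> complex) \<Rightarrow> ('i \<Rightarrow> complex)) \<Rightarrow> bool" where
  "biholomorphism I J X Y f g \<longleftrightarrow>
     holo_map I J X Y f \<and> holo_map J I Y X g \<and>
     (\<forall>x\<in>X. g (f x) = x) \<and> (\<forall>y\<in>Y. f (g y) = y)"

text \<open>
  This is \<^const>\<open>covering_space\<close> in the analytic category: the covering map is holomorphic and
  every sheet is mapped biholomorphically, not merely homeomorphically.
\<close>

definition analytic_covering ::
  "'i set \<Rightarrow> 'j set \<Rightarrow> ('i \<Rightarrow> complex) set \<Rightarrow> (('i \<Rightarrow> complex) \<Rightarrow> ('j \<Rightarrow> complex)) \<Rightarrow>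
   ('j \<Rightarrow> complex) set \<Rightarrow> bool" where
  "analytic_covering I J c p S \<longleftrightarrow>
     holo_map I J c S p \<and> p ` c = S \<and>
     (\<forall>x\<in>S. \<exists>T. x \<in> T \<and> openin (top_of_set S) T \<and>
        (\<exists>v. \<Union>v = c \<inter> p -` T \<and>
             (\<forall>u\<in>v. openin (top_of_set c) u) \<and>
             pairwise disjnt v \<and>
             (\<forall>u\<in>v. \<exists>q. biholomorphism I J u T p q)))"

lemma holo_map_continuous_on:
  assumes "holo_map I J X Y f"
  shows "continuous_on X f"
proof (rule continuous_on_coordinatewise_then_product)
  fix j
  have sub: "X \<subseteq> cspace I" "Y \<subseteq> cspace J" "f ` X \<subseteq> Y"
    and ex: "\<forall>j\<in>J. \<forall>a\<in>X. \<exists>W F. a \<in> W \<and> holo_fun I W F \<and> (\<forall>z\<in>X \<inter> W. f z j = F z)"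
    using assms unfolding holo_map_def by auto
  show "continuous_on X (\<lambda>z. f z j)"
  proof (cases "j \<in> J")
    case False
    have "f z j = 0" if "z \<in> X" for z
    proof -
      have "f z \<in> cspace J" using sub that by auto
      then show ?thesis using False by (simp add: cspace_def)
    qed
    then have "continuous_on X (\<lambda>z. f z j) \<longleftrightarrow> continuous_on X (\<lambda>z. 0 :: complex)"
      by (intro continuous_on_cong refl)
    then show ?thesis by simp
  next
    case True
    show ?thesis
      unfolding continuous_on_def
    proof
      fix a assume a: "a \<in> X"
      from bspec[OF bspec[OF ex True] a] obtain W F
        where W: "a \<in> W" "holo_fun I W F" "\<forall>z\<in>X \<inter> W. f z j = F z"
        by (elim exE conjE) (rule that)
      have "openin (top_of_set (cspace I)) W" and F: "continuous_on W F"
        using W(2) unfolding holo_fun_def by simp_all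
      then obtain U where U: "open U" "W = cspace I \<inter> U"
        by (auto simp: openin_open)
      have eq: "X \<inter> U = X \<inter> W" using U(2) sub(1) by auto
      have "continuous_on (X \<inter> W) F"
        by (rule continuous_on_subset[OF F]) simp
      moreover have "continuous_on (X \<inter> W) F \<longleftrightarrow> continuous_on (X \<inter> W) (\<lambda>z. f z j)"
        by (rule continuous_on_cong[OF refl]) (use W(3) in simp)
      ultimately have "((\<lambda>z. f z j) \<longlongrightarrow> f a j) (at a within X \<inter> W)"
        using a W(1) by (simp add: continuous_on_def)
      moreover have "at a within X \<inter> U = at a within X"
        by (rule at_within_nhd[where S = U]) (use U W(1) in simp_all)
      ultimately show "((\<lambda>z. f z j) \<longlongrightarrow> f a j) (at a within X)" 
        by (simp only: eq)
    qed
  qed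
qed

lemma biholomorphism_imp_homeomorphism:
  assumes "biholomorphism I J X Y f g"
  shows "homeomorphism X Y f g"
proof (rule homeomorphismI)
  have h: "holo_map I J X Y f" "holo_map J I Y X g"
    using assms unfolding biholomorphism_def by blast+
  show "continuous_on X f" "continuous_on Y g"
    by (rule h[THEN holo_map_continuous_on])+
  show "f ` X \<subseteq> Y" "g ` Y \<subseteq> X"
    using h unfolding holo_map_def by blast+
  show "\<And>x. x \<in> X \<Longrightarrow> g (f x) = x" "\<And>y. y \<in> Y \<Longrightarrow> f (g y) = y"
    using assms unfolding biholomorphism_def by blast+
qed

lemma analytic_covering_imp_covering_space:
  assumes "analytic_covering I J c p S"
  shows "covering_space c p S"
proof -
  note A = assms[unfolded analytic_covering_def]
  show ?thesis
    unfolding covering_space_def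
  proof (intro conjI ballI)
    show "continuous_on c p"
      using A by (elim conjE) (rule holo_map_continuous_on)
    show "p ` c = S"
      using A by (elim conjE)
    fix x assume x: "x \<in> S"
    from bspec[OF A[THEN conjunct2, THEN conjunct2] x] obtain T v where
      T: "x \<in> T" "openin (top_of_set S) T" and v: "\<Union>v = c \<inter> p -` T"
        "\<forall>u\<in>v. openin (top_of_set c) u" "pairwise disjnt v"
      and q: "\<forall>u\<in>v. \<exists>q. biholomorphism I J u T p q"
      by (elim exE conjE) (rule that)
    have "\<forall>u\<in>v. \<exists>q. homeomorphism u T p q"
    proof
      fix u assume "u \<in> v"
      from bspec[OF q this] obtain q where "biholomorphism I J u T p q" ..
      then show "\<exists>q. homeomorphism u T p q"
        by (intro exI biholomorphism_imp_homeomorphism)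
    qed
    with T v show "\<exists>T. x \<in> T \<and> openin (top_of_set S) T \<and>
        (\<exists>v. \<Union>v = c \<inter> p -` T \<and> (\<forall>u\<in>v. openin (top_of_set c) u) \<and>
             pairwise disjnt v \<and> (\<forall>u\<in>v. \<exists>q. homeomorphism u T p q))"
      by (intro exI conjI)
  qed
qed

section \<open>Deck transformations\<close>

text \<open>
  The self-homeomorphisms of the total space over the base, under composition. As in
  \<^const>\<open>BijGroup\<close>, maps are normalised to be undefined off \<open>c\<close>. No holomorphy is required:
  for an analytic covering it is automatic.
\<close>

definition deck_group ::
  "'a::topological_space set \<Rightarrow> ('a \<Rightarrow> 'b) \<Rightarrow> ('a \<Rightarrow> 'a) monoid" where
  "deck_group c p = (BijGroup c)
     \<lparr>carrier := {f \<in> Bij c. (\<exists>g. homeomorphism c c f g) \<and> (\<forall>z\<in>c. p (f z) = p z)}\<rparr>"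

section \<open>The varieties and the covering map\<close>

text \<open>
  Matrix entries \<open>x (i, j)\<close> and the coordinates \<open>\<nu> (i, m)\<close> (written \<open>\<nu>\<^sub>i\<^sub>m\<close> on paper) are
  indexed from 1; the matrices of \<open>Jordan_Normal_Form\<close> are indexed from 0, whence the \<open>Suc\<close>s.
\<close>

definition mat_index :: "nat \<Rightarrow> (nat \<times> nat) set" where
  "mat_index n = {1..n} \<times> {1..n}"

definition eig_index :: "nat \<Rightarrow> (nat \<times> nat) set" where
  "eig_index n = {(i, m). m \<in> {1..n} \<and> i \<in> {1..m}}"

definition block :: "nat \<Rightarrow> (nat \<times> nat \<Rightarrow> complex) \<Rightarrow> complex Matrix.mat" where
  "block m x = Matrix.mat m m (\<lambda>(i, j). x (Suc i, Suc j))"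

definition diag_of :: "nat \<Rightarrow> (nat \<times> nat \<Rightarrow> complex) \<Rightarrow> complex Matrix.mat" where
  "diag_of m \<nu> = mat_diag m (\<lambda>i. \<nu> (Suc i, m))"

definition M_Omega :: "nat \<Rightarrow> (nat \<times> nat \<Rightarrow> complex) set" where
  "M_Omega n = {x \<in> cspace (mat_index n).
     (\<forall>m\<in>{1..n}. card (spectrum (block m x)) = m) \<and>
     (\<forall>m\<in>{1..n-1}. spectrum (block m x) \<inter> spectrum (block (m + 1) x) = {})}"

definition e_Omega :: "nat \<Rightarrow> (nat \<times> nat \<Rightarrow> complex) set" where
  "e_Omega n = {\<nu> \<in> cspace (eig_index n).
     (\<forall>m\<in>{1..n}. inj_on (\<lambda>i. \<nu> (i, m)) {1..m}) \<and>
     (\<forall>m\<in>{1..n-1}. \<forall>i\<in>{1..m}. \<forall>j\<in>{1..m+1}. \<nu> (i, m) \<noteq> \<nu> (j, m + 1))}"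

definition M_Omega_e :: "nat \<Rightarrow> ((nat \<times> nat) + (nat \<times> nat) \<Rightarrow> complex) set" where
  "M_Omega_e n = {case_sum \<nu> x | \<nu> x. \<nu> \<in> e_Omega n \<and> x \<in> M_Omega n \<and>
     (\<forall>m\<in>{1..n}. similar_mat (diag_of m \<nu>) (block m x))}"

definition pi_map :: "((nat \<times> nat) + (nat \<times> nat) \<Rightarrow> complex) \<Rightarrow> (nat \<times> nat \<Rightarrow> complex)" where
  "pi_map z = z \<circ> Inr"

definition Sigma_group :: "nat \<Rightarrow> (nat \<Rightarrow> nat \<Rightarrow> nat) monoid" where
  "Sigma_group n = product_group {1..n} sym_group"

definition Sigma_act_eig ::
  "nat \<Rightarrow> (nat \<Rightarrow> nat \<Rightarrow> nat) \<Rightarrow> (nat \<times> nat \<Rightarrow> complex) \<Rightarrow> (nat \<times> nat \<Rightarrow> complex)" where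
  "Sigma_act_eig n \<sigma> \<nu> =
     (\<lambda>(i, m). if (i, m) \<in> eig_index n then \<nu> (inv' (\<sigma> m) i, m) else 0)"

definition Sigma_act ::
  "nat \<Rightarrow> (nat \<Rightarrow> nat \<Rightarrow> nat) \<Rightarrow>
   ((nat \<times> nat) + (nat \<times> nat) \<Rightarrow> complex) \<Rightarrow> ((nat \<times> nat) + (nat \<times> nat) \<Rightarrow> complex)" where
  "Sigma_act n \<sigma> z = case_sum (Sigma_act_eig n \<sigma> (z \<circ> Inl)) (z \<circ> Inr)"

end

theory Submission
  imports Defs
begin

text \<open>
  If \<open>x\<^sub>0\<close> has distinct eigenvalues \<open>a\<^sub>i\<close> in size \<open>m\<close>, then for \<open>x\<close> near \<open>x\<^sub>0\<close> the value of the
  characteristic polynomial of \<open>x\<close> at \<open>a\<^sub>i\<close> is smaller than \<open>\<epsilon>\<^sup>m\<close>, so some eigenvalue of \<open>x\<close> lies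
  within \<open>\<epsilon>\<close> of \<open>a\<^sub>i\<close>; counting shows that it is unique. These eigenvalues are holomorphic
  functions of \<open>x\<close>, so every labelling of the eigenvalues of \<open>x\<^sub>0\<close> extends to a sheet.

  The group \<open>\<Sigma>\<^sub>n\<close> acts simply transitively on the fibres. A deck transformation agrees at one
  point with an element of \<open>\<Sigma>\<^sub>n\<close>, hence everywhere, provided that the total space is connected.
  Connectedness holds because the total space is the continuous image of
  \<open>e\<^sub>\<Omega>\<close> times a torus: a bordered matrix with last column \<open>s\<close> in an eigenbasis of the
  smaller block, with eigenvalues \<open>\<nu>\<^sub>k\<close>, has the eigenvalue \<open>\<mu>\<close> exactly if
  \<open>\<mu> = d + \<Sum>\<^sub>k c\<^sub>k s\<^sub>k / (\<mu> - \<nu>\<^sub>k)\<close>, with eigenvector coordinates \<open>s\<^sub>k / (\<mu> - \<nu>\<^sub>k)\<close> and 1. By partial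
  fractions the prescribed eigenvalues determine \<open>d\<close> and the products \<open>c\<^sub>k s\<^sub>k\<close>, which are
  nonzero, and \<open>s\<close> is arbitrary with nonzero entries.
\<close>

unbundle no vec_syntax and no fps_syntax

section \<open>Eigenvectors of the upper left blocks\<close>

lemma block_carrier [simp]: "block m x \<in> carrier_mat m m"
  by (simp add: block_def)

lemma block_index [simp]: "i < m \<Longrightarrow> j < m \<Longrightarrow> block m x $$ (i, j) = x (Suc i, Suc j)"
  by (simp add: block_def)

lemma sum_nat_shift: "sum f {1..m} = (\<Sum>k = 0..<m. f (Suc k))"
  by (simp add: sum.atLeast1_atMost_eq atLeast0LessThan)

lemma block_mult_vec_index:
  "i < m \<Longrightarrow> (block m x *\<^sub>v Matrix.vec m (\<lambda>k. v (Suc k))) $ i = (\<Sum>k\<in>{1..m}. x (Suc i, k) * v k)"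
  unfolding sum_nat_shift by (simp add: scalar_prod_def block_def)

text \<open>Moves the eigenvector equation to functions indexed from 1, so that all later
  computations are finite sums over \<open>{1..m}\<close>.\<close>

lemma eigenvalue_block_iff:
  "eigenvalue (block m x) l \<longleftrightarrow>
     (\<exists>v. (\<exists>i\<in>{1..m}. v i \<noteq> 0) \<and> (\<forall>i\<in>{1..m}. (\<Sum>k\<in>{1..m}. x (i, k) * v k) = l * v i))"
  (is "_ \<longleftrightarrow> (\<exists>v. ?P v)")
proof
  assume "eigenvalue (block m x) l"
  then obtain w where w: "w \<in> carrier_vec m" "w \<noteq> 0\<^sub>v m" "block m x *\<^sub>v w = l \<cdot>\<^sub>v w"
    unfolding eigenvalue_def eigenvector_def by (auto simp: block_def)
  define v where "v i = w $ (i - 1)" for i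
  have wv: "w = Matrix.vec m (\<lambda>k. v (Suc k))"
    using w(1) by (auto simp: v_def)
  obtain i where "i < m" "w $ i \<noteq> 0"
    using w(1,2) by (metis carrier_vecD eq_vecI index_zero_vec)
  then have "\<exists>i\<in>{1..m}. v i \<noteq> 0"
    by (intro bexI[of _ "Suc i"]) (auto simp: v_def)
  moreover have "(\<Sum>k\<in>{1..m}. x (i, k) * v k) = l * v i" if i: "i \<in> {1..m}" for i
  proof -
    from i have im: "i - 1 < m" "Suc (i - 1) = i" by auto
    have "(block m x *\<^sub>v w) $ (i - 1) = l * v i"
      using w(1) im by (simp add: w(3) v_def)
    then show ?thesis
      unfolding wv block_mult_vec_index[OF im(1)] im(2) .
  qed
  ultimately show "\<exists>v. ?P v" by blast
next
  assume "\<exists>v. ?P v"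
  then obtain v where v: "?P v" ..
  define w where "w = Matrix.vec m (\<lambda>k. v (Suc k))"
  obtain i where i: "i \<in> {1..m}" "v i \<noteq> 0" using v by blast
  then have "w $ (i - 1) \<noteq> 0\<^sub>v m $ (i - 1)" by (auto simp: w_def)
  then have "w \<noteq> 0\<^sub>v m" by auto
  moreover have "block m x *\<^sub>v w = l \<cdot>\<^sub>v w"
  proof (rule eq_vecI)
    fix k assume "k < dim_vec (l \<cdot>\<^sub>v w)"
    then have k: "k < m" by (simp add: w_def)
    show "(block m x *\<^sub>v w) $ k = (l \<cdot>\<^sub>v w) $ k"
      unfolding w_def block_mult_vec_index[OF k] using v k by (simp add: w_def)
  qed (simp add: w_def block_def)
  ultimately show "eigenvalue (block m x) l"
    unfolding eigenvalue_def eigenvector_def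
    by (intro exI[of _ w]) (simp add: w_def block_def)
qed

text \<open>Multiplying a vanishing combination by \<open>A - l\<^sub>a\<close> for all \<open>a\<close> but one isolates one coefficient.\<close>

lemma eigenvectors_independent:
  fixes g :: "'i \<Rightarrow> 'j \<Rightarrow> 'a::field"
  assumes fin: "finite I" "finite J"
    and eig: "\<And>i j. i \<in> I \<Longrightarrow> j \<in> J \<Longrightarrow> (\<Sum>k\<in>I. a i k * g k j) = l j * g i j"
    and inj: "inj_on l J"
    and nz: "\<And>j. j \<in> J \<Longrightarrow> \<exists>i\<in>I. g i j \<noteq> 0"
    and dep: "\<And>i. i \<in> I \<Longrightarrow> (\<Sum>j\<in>J. g i j * c j) = 0"
    and q: "q \<in> J"
  shows "c q = 0"
proof -
  \<comment> \<open>\<open>K\<close> collects the indices already used: applying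
    \<open>a - l r\<close> to the combination multiplies the coefficient of the \<open>j\<close>-th
    eigenvector by \<open>l j - l r\<close>.\<close>
  have claim: "\<forall>i\<in>I. (\<Sum>j\<in>J. g i j * ((\<Prod>r\<in>K. l j - l r) * c j)) = 0" if "finite K" for K
    using that
  proof (induction K)
    case empty
    then show ?case using dep by simp
  next
    case (insert r K)
    define d where "d j = (\<Prod>r\<in>K. l j - l r) * c j" for j
    have IH: "\<And>i. i \<in> I \<Longrightarrow> (\<Sum>j\<in>J. g i j * d j) = 0"
      using insert.IH by (simp add: d_def)
    show ?case
    proof
      fix i assume i: "i \<in> I"
      have "(\<Sum>j\<in>J. g i j * ((\<Prod>r\<in>insert r K. l j - l r) * c j))
          = (\<Sum>j\<in>J. l j * g i j * d j) - l r * (\<Sum>j\<in>J. g i j * d j)"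
        using insert.hyps by (simp add: d_def sum_distrib_left flip: sum_subtractf)
          (simp add: algebra_simps)
      also have "(\<Sum>j\<in>J. l j * g i j * d j) = (\<Sum>j\<in>J. \<Sum>k\<in>I. a i k * (g k j * d j))"
        by (intro sum.cong refl) (simp add: eig[OF i, symmetric] sum_distrib_right mult.assoc)
      also have "\<dots> = (\<Sum>k\<in>I. a i k * (\<Sum>j\<in>J. g k j * d j))"
        by (subst sum.swap) (simp add: sum_distrib_left)
      also have "\<dots> = 0" by (simp add: IH)
      finally show "(\<Sum>j\<in>J. g i j * ((\<Prod>r\<in>insert r K. l j - l r) * c j)) = 0"
        by (simp add: IH[OF i])
    qed
  qed
  obtain i where i: "i \<in> I" "g i q \<noteq> 0" using nz[OF q] by blast
  have "0 = (\<Sum>j\<in>J. g i j * ((\<Prod>r\<in>J - {q}. l j - l r) * c j))"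
    using claim[of "J - {q}"] fin i by simp
  \<comment> \<open>For \<open>j \<noteq> q\<close> the product contains the factor
    \<open>l j - l j\<close>.\<close>
  also have "\<dots> = (\<Sum>j\<in>{q}. g i j * ((\<Prod>r\<in>J - {q}. l j - l r) * c j))"
    by (rule sum.mono_neutral_right) (use fin q in \<open>auto intro!: prod_zero\<close>)
  finally have "(\<Prod>r\<in>J - {q}. l q - l r) * c q = 0" using i by simp
  moreover have "(\<Prod>r\<in>J - {q}. l q - l r) \<noteq> 0"
    using fin inj q by (auto simp: inj_on_def)
  ultimately show ?thesis by simp
qed

section \<open>Inverse matrices and linear systems\<close>

text \<open>The inverse is written through the adjugate so that its entries are visibly continuous
  in those of \<open>g\<close>. The shift by 1 passes from indices starting at 1 to those of the
  matrix type.\<close>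

definition inv_fun :: "nat \<Rightarrow> (nat \<times> nat \<Rightarrow> complex) \<Rightarrow> nat \<times> nat \<Rightarrow> complex" where
  "inv_fun m g = (\<lambda>(i, j). adj_mat (block m g) $$ (i - 1, j - 1) / det (block m g))"

lemma det_block_nonzero:
  assumes "\<And>c. (\<And>i. i \<in> {1..m} \<Longrightarrow> (\<Sum>j\<in>{1..m}. g (i, j) * c j) = 0) \<Longrightarrow> \<forall>j\<in>{1..m}. c j = 0"
  shows "det (block m g) \<noteq> 0"
proof
  assume "det (block m g) = 0"
  then obtain w where w: "w \<in> carrier_vec m" "w \<noteq> 0\<^sub>v m" "block m g *\<^sub>v w = 0\<^sub>v m"
    using det_0_iff_vec_prod_zero_field[OF block_carrier] by blast
  define v where "v i = w $ (i - 1)" for i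
  have wv: "w = Matrix.vec m (\<lambda>k. v (Suc k))"
    using w(1) by (auto simp: v_def)
  have "\<forall>j\<in>{1..m}. v j = 0"
  proof (rule assms)
    fix i assume i: "i \<in> {1..m}"
    then have im: "i - 1 < m" "Suc (i - 1) = i" by auto
    have "(block m g *\<^sub>v w) $ (i - 1) = 0"
      using im by (simp add: w(3))
    then show "(\<Sum>k\<in>{1..m}. g (i, k) * v k) = 0"
      unfolding wv block_mult_vec_index[OF im(1)] im(2) .
  qed
  then have "w = 0\<^sub>v m" by (intro eq_vecI) (auto simp: wv)
  with w(2) show False ..
qed

lemma inv_fun_block:
  assumes "det (block m g) \<noteq> 0"
  shows "block m g * block m (inv_fun m g) = 1\<^sub>m m" "block m (inv_fun m g) * block m g = 1\<^sub>m m"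
proof -
  note adj = adj_mat[OF block_carrier[of m g]]
  have eq: "block m (inv_fun m g) = (1 / det (block m g)) \<cdot>\<^sub>m adj_mat (block m g)"
    by (rule eq_matI) (use adj(1) in \<open>auto simp: inv_fun_def block_def\<close>)
  show "block m g * block m (inv_fun m g) = 1\<^sub>m m"
    unfolding eq using assms adj
    by (subst mult_smult_distrib[of _ m m _ m]) auto
  show "block m (inv_fun m g) * block m g = 1\<^sub>m m"
    unfolding eq using assms adj
    by (subst mult_smult_assoc_mat[of _ m m _ m]) auto
qed

lemma block_mult_index:
  assumes "i \<in> {1..m}" "j \<in> {1..m}"
  shows "(block m g * block m h) $$ (i - 1, j - 1) = (\<Sum>k\<in>{1..m}. g (i, k) * h (k, j))"
  unfolding sum_nat_shift using assms
  by (auto simp: scalar_prod_def block_def)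

lemma inv_fun_sum:
  assumes "det (block m g) \<noteq> 0" "i \<in> {1..m}" "j \<in> {1..m}"
  shows "(\<Sum>k\<in>{1..m}. g (i, k) * inv_fun m g (k, j)) = (if i = j then 1 else 0)"
    and "(\<Sum>k\<in>{1..m}. inv_fun m g (i, k) * g (k, j)) = (if i = j then 1 else 0)"
  unfolding block_mult_index[OF assms(2,3), symmetric] inv_fun_block[OF assms(1)]
  using assms(2,3) by auto

text \<open>Used to expand a column vector in the basis formed by the columns of \<open>g\<close>;
  \<open>inv_fun_solve_left\<close> does the same for a row with prescribed products with these
  columns.\<close>

lemma inv_fun_solve_right:
  assumes "det (block m g) \<noteq> 0" "i \<in> {1..m}"
  shows "(\<Sum>k\<in>{1..m}. g (i, k) * (\<Sum>j\<in>{1..m}. inv_fun m g (k, j) * c j)) = c i"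
proof -
  have "(\<Sum>k\<in>{1..m}. g (i, k) * (\<Sum>j\<in>{1..m}. inv_fun m g (k, j) * c j))
      = (\<Sum>j\<in>{1..m}. (\<Sum>k\<in>{1..m}. g (i, k) * inv_fun m g (k, j)) * c j)"
    by (simp add: sum_distrib_left sum_distrib_right mult.assoc) (rule sum.swap)
  also have "\<dots> = (\<Sum>j\<in>{1..m}. if j = i then c j else 0)"
    by (intro sum.cong refl) (simp only: inv_fun_sum[OF assms], auto)
  finally show ?thesis using assms(2) by (simp add: sum.delta)
qed

lemma inv_fun_solve_left:
  assumes "det (block m g) \<noteq> 0" "i \<in> {1..m}"
  shows "(\<Sum>k\<in>{1..m}. (\<Sum>j\<in>{1..m}. c j * inv_fun m g (j, k)) * g (k, i)) = c i"
proof -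
  have "(\<Sum>k\<in>{1..m}. (\<Sum>j\<in>{1..m}. c j * inv_fun m g (j, k)) * g (k, i))
      = (\<Sum>j\<in>{1..m}. c j * (\<Sum>k\<in>{1..m}. inv_fun m g (j, k) * g (k, i)))"
    by (simp add: sum_distrib_left sum_distrib_right mult.assoc) (rule sum.swap)
  also have "\<dots> = (\<Sum>j\<in>{1..m}. if j = i then c j else 0)"
    by (intro sum.cong refl) (simp only: inv_fun_sum[OF assms(1) _ assms(2)], auto)
  finally show ?thesis using assms(2) by (simp add: sum.delta)
qed

text \<open>Nonzero eigenvectors for distinct eigenvalues are independent, so the matrix with these
  columns has trivial kernel.\<close>

lemma det_eigenvectors_nonzero:
  assumes eig: "\<And>i j. i \<in> {1..m} \<Longrightarrow> j \<in> {1..m} \<Longrightarrow> (\<Sum>k\<in>{1..m}. x (i, k) * g (k, j)) = l j * g (i, j)"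
    and inj: "inj_on l {1..m}"
    and nz: "\<And>j. j \<in> {1..m} \<Longrightarrow> \<exists>i\<in>{1..m}. g (i, j) \<noteq> 0"
  shows "det (block m g) \<noteq> 0"
proof (rule det_block_nonzero)
  fix c assume dep: "\<And>i. i \<in> {1..m} \<Longrightarrow> (\<Sum>j\<in>{1..m}. g (i, j) * c j) = 0"
  show "\<forall>j\<in>{1..m}. c j = 0"
  proof
    fix q assume "q \<in> {1..m}"
    with eig inj nz dep show "c q = 0"
      by (rule eigenvectors_independent[where a = "\<lambda>i k. x (i, k)" and g = "\<lambda>i j. g (i, j)",
            OF finite_atLeastAtMost finite_atLeastAtMost])
  qed
qed

section \<open>Spectra of the blocks and membership in the total space\<close>

text \<open>One eigenvector is chosen for each of the \<open>m\<close> distinct eigenvalues. The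
  matrix \<open>G\<close> with these columns is invertible and satisfies \<open>X G = G D\<close>
  with \<open>D\<close> diagonal.\<close>

lemma similar_diag_of_block:
  assumes inj: "inj_on (\<lambda>i. \<nu> (i, m)) {1..m}"
    and ev: "\<And>i. i \<in> {1..m} \<Longrightarrow> \<nu> (i, m) \<in> spectrum (block m x)"
  shows "similar_mat (diag_of m \<nu>) (block m x)"
proof -
  have "\<forall>j\<in>{1..m}. \<exists>v. (\<exists>i\<in>{1..m}. v i \<noteq> 0) \<and>
      (\<forall>i\<in>{1..m}. (\<Sum>k\<in>{1..m}. x (i, k) * v k) = \<nu> (j, m) * v i)"
    using ev unfolding spectrum_def by (simp add: eigenvalue_block_iff)
  then obtain V where V: "\<forall>j\<in>{1..m}. (\<exists>i\<in>{1..m}. V j i \<noteq> 0) \<and>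
      (\<forall>i\<in>{1..m}. (\<Sum>k\<in>{1..m}. x (i, k) * V j k) = \<nu> (j, m) * V j i)"
    by metis
  define g where "g = (\<lambda>(i, j). V j i)"
  have eig: "(\<Sum>k\<in>{1..m}. x (i, k) * g (k, j)) = \<nu> (j, m) * g (i, j)"
    if "i \<in> {1..m}" "j \<in> {1..m}" for i j using V that by (simp add: g_def)
  have det: "det (block m g) \<noteq> 0"
    by (rule det_eigenvectors_nonzero[OF eig inj]) (use V in \<open>auto simp: g_def\<close>)
  have D: "diag_of m \<nu> \<in> carrier_mat m m" by (simp add: diag_of_def)
  let ?G = "block m g" and ?H = "block m (inv_fun m g)" and ?X = "block m x"
  have XG: "?X * ?G = ?G * diag_of m \<nu>"
  proof (rule eq_matI)
    fix i j assume "i < dim_row (?G * diag_of m \<nu>)" "j < dim_col (?G * diag_of m \<nu>)"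
    then have ij: "i < m" "j < m" by (auto simp: block_def diag_of_def mat_diag_def)
    have "(?X * ?G) $$ (i, j) = (\<Sum>k\<in>{1..m}. x (Suc i, k) * g (k, Suc j))"
      using block_mult_index[of "Suc i" m "Suc j" x g] ij by simp
    also have "\<dots> = \<nu> (Suc j, m) * g (Suc i, Suc j)"
      using ij by (intro eig) auto
    also have "\<dots> = (?G * diag_of m \<nu>) $$ (i, j)"
      unfolding diag_of_def by (subst mat_diag_mult_right[of _ m]) (use ij in auto)
    finally show "(?X * ?G) $$ (i, j) = (?G * diag_of m \<nu>) $$ (i, j)" .
  qed (auto simp: block_def diag_of_def mat_diag_def)
  have "?H * ?X * ?G = ?H * (?G * diag_of m \<nu>)"
    by (simp add: XG assoc_mult_mat[of _ m m _ m _ m])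
  also have "\<dots> = diag_of m \<nu>"
    using D by (simp add: assoc_mult_mat[of _ m m _ m _ m, symmetric] inv_fun_block[OF det])
  finally show ?thesis
    by (intro similar_matI[of _ _ ?H ?G m] inv_fun_block[OF det]) (use D in auto)
qed

lemma spectrum_diag_of: "spectrum (diag_of m \<nu>) = (\<lambda>i. \<nu> (i, m)) ` {1..m}"
proof -
  have c: "diag_of m \<nu> \<in> carrier_mat m m" by (simp add: diag_of_def)
  have "upper_triangular (diag_of m \<nu>)"
    by (auto simp: upper_triangular_def diag_of_def mat_diag_def)
  from char_poly_upper_triangular[OF c this]
  have "spectrum (diag_of m \<nu>) = set (diag_mat (diag_of m \<nu>))"
    unfolding spectrum_root_char_poly[OF c] by (auto simp: poly_prod_list prod_list_zero_iff o_def)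
  also have "\<dots> = (\<lambda>i. \<nu> (Suc i, m)) ` {0..<m}"
    by (auto simp: diag_mat_def diag_of_def mat_diag_def)
  also have "\<dots> = (\<lambda>i. \<nu> (i, m)) ` Suc ` {0..<m}"
    by (simp only: image_image)
  also have "Suc ` {0..<m} = {1..m}"
    by (simp add: image_Suc_atLeastLessThan atLeastLessThanSuc_atLeastAtMost)
  finally show ?thesis .
qed

lemma spectrum_similar:
  assumes "similar_mat A (B :: complex Matrix.mat)"
  shows "spectrum A = spectrum B"
proof -
  obtain k where "A \<in> carrier_mat k k" "B \<in> carrier_mat k k"
    using similar_matD[OF assms] by auto
  then show ?thesis
    using char_poly_similar[OF assms] by (simp add: spectrum_root_char_poly)
qed

lemma spectrum_block_eq:
  assumes inj: "inj_on (\<lambda>i. \<nu> (i, m)) {1..m}"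
    and ev: "\<And>i. i \<in> {1..m} \<Longrightarrow> \<nu> (i, m) \<in> spectrum (block m x)"
  shows "spectrum (block m x) = (\<lambda>i. \<nu> (i, m)) ` {1..m}"
  using spectrum_similar[OF similar_diag_of_block[OF assms]] spectrum_diag_of by metis

text \<open>Replaces conjugacy by membership in spectra. The \<open>m\<close> distinct numbers
  \<open>\<nu> (i, m)\<close> exhaust the spectrum of the block of size \<open>m\<close>, so the
  genericity of the matrix follows from that of \<open>\<nu>\<close>.\<close>

lemma M_Omega_e_iff:
  "z \<in> M_Omega_e n \<longleftrightarrow> z \<circ> Inl \<in> e_Omega n \<and> z \<circ> Inr \<in> cspace (mat_index n) \<and>
     (\<forall>m\<in>{1..n}. \<forall>i\<in>{1..m}. z (Inl (i, m)) \<in> spectrum (block m (z \<circ> Inr)))"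
  (is "?L \<longleftrightarrow> ?R")
proof
  assume ?L
  then obtain \<nu> x where z: "z = case_sum \<nu> x" and nu: "\<nu> \<in> e_Omega n" "x \<in> M_Omega n"
    and sim: "\<forall>m\<in>{1..n}. similar_mat (diag_of m \<nu>) (block m x)"
    unfolding M_Omega_e_def by blast
  have "\<nu> (i, m) \<in> spectrum (block m x)" if "m \<in> {1..n}" "i \<in> {1..m}" for m i
    using spectrum_similar[OF bspec[OF sim that(1)]] that(2) by (auto simp: spectrum_diag_of)
  then show ?R using nu by (simp add: z case_sum_o_inj M_Omega_def)
next
  assume R: ?R
  define \<nu> x where "\<nu> = z \<circ> Inl" and "x = z \<circ> Inr"
  have z: "z = case_sum \<nu> x"
    by (auto simp: \<nu>_def x_def fun_eq_iff split: sum.split)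
  from R have nu: "\<nu> \<in> e_Omega n" "x \<in> cspace (mat_index n)"
    and ev: "\<And>m i. m \<in> {1..n} \<Longrightarrow> i \<in> {1..m} \<Longrightarrow> \<nu> (i, m) \<in> spectrum (block m x)"
    by (simp_all add: \<nu>_def x_def)
  have inj: "inj_on (\<lambda>i. \<nu> (i, m)) {1..m}" if "m \<in> {1..n}" for m
    using nu(1) that by (simp add: e_Omega_def)
  have spec: "spectrum (block m x) = (\<lambda>i. \<nu> (i, m)) ` {1..m}" if "m \<in> {1..n}" for m
    by (rule spectrum_block_eq) (use inj ev that in auto)
  have "x \<in> M_Omega n"
    unfolding M_Omega_def
  proof (safe intro!: nu(2))
    fix m assume "m \<in> {1..n}"
    then show "card (spectrum (block m x)) = m"
      using card_image[OF inj] by (simp add: spec)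
  next
    fix m l assume "m \<in> {1..n - 1}" "l \<in> spectrum (block m x)" "l \<in> spectrum (block (m + 1) x)"
    then show "l \<in> {}"
      using nu(1) by (auto simp: spec e_Omega_def)
  qed
  moreover have "\<forall>m\<in>{1..n}. similar_mat (diag_of m \<nu>) (block m x)"
    using similar_diag_of_block inj ev by blast
  ultimately show ?L
    unfolding M_Omega_e_def using z nu by blast
qed

lemma M_Omega_e_spectrum:
  assumes "z \<in> M_Omega_e n" "m \<in> {1..n}"
  shows "spectrum (block m (z \<circ> Inr)) = (\<lambda>i. z (Inl (i, m))) ` {1..m}"
    and "inj_on (\<lambda>i. z (Inl (i, m))) {1..m}"
proof -
  have "z \<circ> Inl \<in> e_Omega n" using assms by (simp add: M_Omega_e_iff)
  then show inj: "inj_on (\<lambda>i. z (Inl (i, m))) {1..m}"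
    using assms(2) by (auto simp: e_Omega_def)
  show "spectrum (block m (z \<circ> Inr)) = (\<lambda>i. z (Inl (i, m))) ` {1..m}"
    using spectrum_block_eq[of "z \<circ> Inl" m "z \<circ> Inr"] inj assms by (simp add: M_Omega_e_iff)
qed

lemma M_Omega_e_pi_map: "z \<in> M_Omega_e n \<Longrightarrow> pi_map z \<in> M_Omega n"
  by (auto simp: M_Omega_e_def pi_map_def case_sum_o_inj)

text \<open>Here genericity passes from \<open>x\<close> to \<open>\<nu>\<close>: a labelling of a
  spectrum with \<open>m\<close> elements by \<open>m\<close> indices that hits all of it is
  injective, and disjoint spectra give the inequalities between consecutive sizes.\<close>

lemma M_Omega_eI:
  assumes x: "x \<in> M_Omega n" and nu: "\<nu> \<in> cspace (eig_index n)"
    and spec: "\<And>m. m \<in> {1..n} \<Longrightarrow> (\<lambda>i. \<nu> (i, m)) ` {1..m} = spectrum (block m x)"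
  shows "case_sum \<nu> x \<in> M_Omega_e n"
proof -
  have "inj_on (\<lambda>i. \<nu> (i, m)) {1..m}" if "m \<in> {1..n}" for m
  proof (rule eq_card_imp_inj_on)
    show "card ((\<lambda>i. \<nu> (i, m)) ` {1..m}) = card {1..m}"
      using x that unfolding spec[OF that] M_Omega_def by simp
  qed simp
  moreover have "\<nu> (i, m) \<noteq> \<nu> (j, m + 1)"
    if "m \<in> {1..n-1}" "i \<in> {1..m}" "j \<in> {1..m+1}" for m i j
  proof -
    have "\<nu> (i, m) \<in> spectrum (block m x)" "\<nu> (j, m + 1) \<in> spectrum (block (m + 1) x)"
      unfolding spec[of m, symmetric] spec[of "m + 1", symmetric]
      using that spec[of m] spec[of "m + 1"] by force+
    moreover have "spectrum (block m x) \<inter> spectrum (block (m + 1) x) = {}"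
      using x that(1) unfolding M_Omega_def by blast
    ultimately show ?thesis by (metis IntI empty_iff)
  qed
  ultimately have "\<nu> \<in> e_Omega n" using nu by (simp add: e_Omega_def)
  moreover have "\<nu> (i, m) \<in> spectrum (block m x)" if "m \<in> {1..n}" "i \<in> {1..m}" for m i
    using spec[OF that(1)] that(2) by auto
  ultimately show ?thesis using x by (simp add: M_Omega_e_iff M_Omega_def case_sum_o_inj)
qed

section \<open>Coordinates on the total space\<close>

text \<open>Clearing denominators in \<open>c(s) = \<Sum>\<^sub>i e\<^sub>i / (s - a\<^sub>i)\<close>; the statement also covers the poles.\<close>

lemma partial_fraction_zero:
  fixes a :: "'i \<Rightarrow> 'a::field"
  assumes fin: "finite I" "finite S" and inj: "inj_on a I"
    and card: "card S > card I + degree c"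
    and eq: "\<And>s. s \<in> S \<Longrightarrow>
      poly c s * (\<Prod>i\<in>I. s - a i) = (\<Sum>i\<in>I. e i * (\<Prod>k\<in>I - {i}. s - a k))"
  shows "c = 0" and "\<And>i. i \<in> I \<Longrightarrow> e i = 0"
proof -
  \<comment> \<open>\<open>F\<close> is the difference of the two cleared sides. Its degree is at
    most \<open>card I + degree c\<close>, but it vanishes on the larger set \<open>S\<close>, so
    \<open>F = 0\<close>.\<close>
  define P where "P K = (\<Prod>i\<in>K. [:- a i, 1:])" for K
  define F where "F = c * P I - (\<Sum>i\<in>I. Polynomial.smult (e i) (P (I - {i})))"
  have degP: "degree (P K) \<le> card K" if "finite K" for K
    using degree_prod_sum_le[OF that, of "\<lambda>i. [:- a i, 1:]"] that by (simp add: P_def o_def)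
  have polyP: "poly (P K) s = (\<Prod>i\<in>K. s - a i)" for K s
    by (simp add: P_def poly_prod)
  have polyF: "poly F s = poly c s * (\<Prod>i\<in>I. s - a i) - (\<Sum>i\<in>I. e i * (\<Prod>k\<in>I - {i}. s - a k))" for s
    by (simp add: F_def poly_sum polyP)
  have deg1: "degree (c * P I) \<le> card I + degree c"
    using degree_mult_le[of c "P I"] degP[OF fin(1)] by linarith
  have "degree (\<Sum>i\<in>I. Polynomial.smult (e i) (P (I - {i}))) \<le> card I"
  proof (rule degree_sum_le[OF fin(1)])
    fix i assume "i \<in> I"
    have "degree (Polynomial.smult (e i) (P (I - {i}))) \<le> degree (P (I - {i}))"
      by (rule degree_smult_le)
    also have "\<dots> \<le> card (I - {i})" using fin by (intro degP) simp
    also have "\<dots> \<le> card I" using fin by (intro card_mono) auto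
    finally show "degree (Polynomial.smult (e i) (P (I - {i}))) \<le> card I" .
  qed
  then have degF: "degree F < card S"
    unfolding F_def using deg1 card by (intro le_less_trans[OF degree_diff_le_max]) simp
  have F0: "F = 0"
  proof (rule ccontr)
    assume "F \<noteq> 0"
    have "card S \<le> card {s. poly F s = 0}"
      using poly_roots_finite[OF \<open>F \<noteq> 0\<close>] by (rule card_mono) (use eq polyF in auto)
    also have "\<dots> \<le> degree F" by (rule card_poly_roots_bound[OF \<open>F \<noteq> 0\<close>])
    finally show False using degF by simp
  qed
  \<comment> \<open>Evaluating \<open>F = 0\<close> at the pole \<open>a i\<close> leaves only the
    \<open>i\<close>-th summand.\<close>
  show e0: "e i = 0" if i: "i \<in> I" for i
  proof -
    have prod0: "(\<Prod>k\<in>I. a i - a k) = 0" using fin i by (intro prod_zero) auto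
    have "0 = (\<Sum>j\<in>I. e j * (\<Prod>k\<in>I - {j}. a i - a k))"
      using polyF[of "a i"] prod0 by (simp add: F0)
    also have "\<dots> = (\<Sum>j\<in>{i}. e j * (\<Prod>k\<in>I - {j}. a i - a k))"
      by (rule sum.mono_neutral_right) (use fin i in \<open>auto intro!: prod_zero\<close>)
    finally have "e i * (\<Prod>k\<in>I - {i}. a i - a k) = 0" by simp
    moreover have "(\<Prod>k\<in>I - {i}. a i - a k) \<noteq> 0"
      using fin inj i by (auto simp: inj_on_def)
    ultimately show ?thesis by simp
  qed
  have "c * P I = 0" using F0 e0 by (simp add: F_def)
  moreover have "P I \<noteq> 0" unfolding P_def using fin by simp
  ultimately show "c = 0" by simp
qed

lemma sum_divide_clear:
  fixes a :: "'i \<Rightarrow> 'a::field"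
  assumes "finite I" "\<And>i. i \<in> I \<Longrightarrow> s \<noteq> a i"
  shows "(\<Sum>i\<in>I. e i / (s - a i)) * (\<Prod>i\<in>I. s - a i) = (\<Sum>i\<in>I. e i * (\<Prod>k\<in>I - {i}. s - a k))"
  unfolding sum_distrib_right
proof (rule sum.cong[OF refl])
  fix i assume i: "i \<in> I"
  have "(\<Prod>i\<in>I. s - a i) = (s - a i) * (\<Prod>k\<in>I - {i}. s - a k)"
    using assms(1) i by (rule prod.remove)
  then show "e i / (s - a i) * (\<Prod>i\<in>I. s - a i) = e i * (\<Prod>k\<in>I - {i}. s - a k)"
    using assms(2)[OF i] by simp
qed

text \<open>A square linear system in the unknowns \<open>e 1, ..., e m, d\<close>. A solution of
  the homogeneous system gives a partial fraction identity with constant polynomial part at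
  \<open>m + 1\<close> points, so \<open>partial_fraction_zero\<close> makes it trivial.\<close>

lemma partial_fraction_exists:
  fixes a \<mu> :: "nat \<Rightarrow> complex"
  assumes inj: "inj_on a {1..m}" "inj_on \<mu> {1..Suc m}"
    and ne: "\<And>i j. i \<in> {1..m} \<Longrightarrow> j \<in> {1..Suc m} \<Longrightarrow> a i \<noteq> \<mu> j"
  shows "\<exists>e d. \<forall>j\<in>{1..Suc m}. (\<Sum>i\<in>{1..m}. e i / (\<mu> j - a i)) + d = \<mu> j"
proof -
  \<comment> \<open>Column \<open>Suc m\<close> belongs to the unknown \<open>d\<close>.\<close>
  define g where "g = (\<lambda>(j, i). if i = Suc m then 1 else 1 / (\<mu> j - a i))"
  have g: "(\<Sum>i\<in>{1..Suc m}. g (j, i) * c i) = (\<Sum>i\<in>{1..m}. c i / (\<mu> j - a i)) + c (Suc m)" for j c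
    by (simp add: g_def)
  have "det (block (Suc m) g) \<noteq> 0"
  proof (rule det_block_nonzero)
    fix c assume "\<And>j. j \<in> {1..Suc m} \<Longrightarrow> (\<Sum>i\<in>{1..Suc m}. g (j, i) * c i) = 0"
    then have sum: "(\<Sum>i\<in>{1..m}. c i / (\<mu> j - a i)) = - c (Suc m)" if "j \<in> {1..Suc m}" for j
      using that unfolding g by (metis add_eq_0_iff2)
    have eq: "poly [:- c (Suc m):] s * (\<Prod>i\<in>{1..m}. s - a i)
        = (\<Sum>i\<in>{1..m}. c i * (\<Prod>k\<in>{1..m} - {i}. s - a k))" if "s \<in> \<mu> ` {1..Suc m}" for s
    proof -
      from that obtain j where j: "j \<in> {1..Suc m}" "s = \<mu> j" by blast
      show ?thesis
        using sum_divide_clear[of "{1..m}" s a c] ne[OF _ j(1)] sum[OF j(1)] unfolding j(2) by force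
    qed
    have card: "card (\<mu> ` {1..Suc m}) > card {1..m} + degree [:- c (Suc m):]"
      using card_image[OF inj(2)] by simp
    note z = partial_fraction_zero[OF _ _ inj(1) card eq]
    have "c (Suc m) = 0" using z(1) by simp
    moreover have "c i = 0" if "i \<in> {1..m}" for i using z(2) that by blast
    ultimately show "\<forall>j\<in>{1..Suc m}. c j = 0"
      by (metis atLeastAtMost_iff le_Suc_eq)
  qed
  note sol = inv_fun_solve_right[OF this, of _ \<mu>, unfolded g]
  show ?thesis by (intro exI ballI) (erule sol)
qed

text \<open>If \<open>e q = 0\<close>, the cleared equation with polynomial part
  \<open>s - d\<close> also holds at the pole \<open>a q\<close>. That makes \<open>m + 2\<close>
  points, which forces the polynomial \<open>s - d\<close> to be zero.\<close>

lemma partial_fraction_nonzero: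
  fixes a \<mu> :: "nat \<Rightarrow> complex"
  assumes inj: "inj_on a {1..m}" "inj_on \<mu> {1..Suc m}"
    and ne: "\<And>i j. i \<in> {1..m} \<Longrightarrow> j \<in> {1..Suc m} \<Longrightarrow> a i \<noteq> \<mu> j"
    and sum: "\<And>j. j \<in> {1..Suc m} \<Longrightarrow> (\<Sum>i\<in>{1..m}. e i / (\<mu> j - a i)) + d = \<mu> j"
    and q: "q \<in> {1..m}"
  shows "e q \<noteq> 0"
proof
  assume e: "e q = 0"
  have sum0: "(\<Sum>i\<in>{1..m}. e i * (\<Prod>k\<in>{1..m} - {i}. a q - a k)) = 0"
    using q e by (intro sum.neutral) (auto intro!: prod_zero)
  have eq: "poly [:- d, 1:] s * (\<Prod>i\<in>{1..m}. s - a i)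
        = (\<Sum>i\<in>{1..m}. e i * (\<Prod>k\<in>{1..m} - {i}. s - a k))" if "s \<in> insert (a q) (\<mu> ` {1..Suc m})" for s
  proof (cases "s = a q")
    case True
    have "(\<Prod>i\<in>{1..m}. a q - a i) = 0" using q by (intro prod_zero) auto
    then show ?thesis using True sum0 by simp
  next
    case False
    with that obtain j where j: "j \<in> {1..Suc m}" "s = \<mu> j" by blast
    have "(\<Sum>i\<in>{1..m}. e i / (\<mu> j - a i)) = poly [:- d, 1:] (\<mu> j)"
      using sum[OF j(1)] by (simp add: algebra_simps)
    then show ?thesis
      using sum_divide_clear[of "{1..m}" s a e] ne[OF _ j(1)] unfolding j(2) by force
  qed
  have card: "card (insert (a q) (\<mu> ` {1..Suc m})) > card {1..m} + degree [:- d, 1:]"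
  proof -
    have "a q \<notin> \<mu> ` {1..Suc m}" using ne q by blast
    then have "card (insert (a q) (\<mu> ` {1..Suc m})) = Suc (card (\<mu> ` {1..Suc m}))"
      by (intro card_insert_disjoint) auto
    then show ?thesis using card_image[OF inj(2)] by simp
  qed
  have "[:- d, 1:] = 0"
    using partial_fraction_zero(1)[OF _ _ inj(1) card eq] by simp
  then show False by simp
qed

section \<open>Eigenvectors of bordered matrices and coordinates from them\<close>

text \<open>
  The eigenvectors of the blocks of \<open>x\<close>, as columns and normalised by last entry 1. The columns
  for the block of size \<open>m + 1\<close> are obtained from those for size \<open>m\<close>, the coordinates \<open>s (k, m)\<close>
  in the latter of the last column of the larger block, and the eigenvalues \<open>\<nu>\<close>.
\<close>

primrec eigvecs ::
  "(nat \<times> nat \<Rightarrow> complex) \<Rightarrow> (nat \<times> nat \<Rightarrow> complex) \<Rightarrow> nat \<Rightarrow> nat \<times> nat \<Rightarrow> complex" where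
  "eigvecs \<nu> s 0 = (\<lambda>_. 0)"
| "eigvecs \<nu> s (Suc m) = (\<lambda>(i, j). if i = Suc m then 1
     else \<Sum>k\<in>{1..m}. eigvecs \<nu> s m (i, k) * (s (k, m) / (\<nu> (j, Suc m) - \<nu> (k, m))))"

definition has_eigvecs ::
  "(nat \<times> nat \<Rightarrow> complex) \<Rightarrow> (nat \<times> nat \<Rightarrow> complex) \<Rightarrow> (nat \<times> nat \<Rightarrow> complex) \<Rightarrow> nat \<Rightarrow> bool" where
  "has_eigvecs \<nu> s x m \<longleftrightarrow> (\<forall>i\<in>{1..m}. \<forall>j\<in>{1..m}.
     (\<Sum>k\<in>{1..m}. x (i, k) * eigvecs \<nu> s m (k, j)) = \<nu> (j, m) * eigvecs \<nu> s m (i, j))"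

lemma has_eigvecs_0 [simp]: "has_eigvecs \<nu> s x 0"
  by (simp add: has_eigvecs_def)

lemma eigvecs_last: "m \<ge> 1 \<Longrightarrow> eigvecs \<nu> s m (m, j) = 1"
  by (cases m) auto

text \<open>The eigenvectors for size \<open>m\<close> see only the earlier columns of
  \<open>s\<close>, so column \<open>m\<close> may be chosen afterwards without changing
  them.\<close>

lemma eigvecs_cong:
  "(\<And>i k. k < m \<Longrightarrow> s (i, k) = s' (i, k)) \<Longrightarrow> eigvecs \<nu> s m = eigvecs \<nu> s' m"
proof (induction m)
  case (Suc m)
  have "eigvecs \<nu> s m = eigvecs \<nu> s' m" "\<And>k. s (k, m) = s' (k, m)"
    using Suc by simp_all
  then show ?case by (auto simp: fun_eq_iff)
qed simp

lemma e_Omega_inj: "\<nu> \<in> e_Omega n \<Longrightarrow> m \<le> n \<Longrightarrow> inj_on (\<lambda>i. \<nu> (i, m)) {1..m}"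
  by (cases "m = 0") (auto simp: e_Omega_def)

lemma e_Omega_neq:
  "\<nu> \<in> e_Omega n \<Longrightarrow> Suc m \<le> n \<Longrightarrow> i \<in> {1..m} \<Longrightarrow> j \<in> {1..Suc m} \<Longrightarrow> \<nu> (i, m) \<noteq> \<nu> (j, Suc m)"
  by (auto simp: e_Omega_def)

text \<open>The last entry 1 makes every column nonzero, and the eigenvalues are distinct.\<close>

lemma det_eigvecs_nonzero:
  assumes "\<nu> \<in> e_Omega n" "m \<le> n" "has_eigvecs \<nu> s x m"
  shows "det (block m (eigvecs \<nu> s m)) \<noteq> 0"
proof (rule det_eigenvectors_nonzero)
  show "inj_on (\<lambda>i. \<nu> (i, m)) {1..m}" using assms by (intro e_Omega_inj)
  show "(\<Sum>k\<in>{1..m}. x (i, k) * eigvecs \<nu> s m (k, j)) = \<nu> (j, m) * eigvecs \<nu> s m (i, j)"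
    if "i \<in> {1..m}" "j \<in> {1..m}" for i j using assms(3) that by (simp add: has_eigvecs_def)
  show "\<exists>i\<in>{1..m}. eigvecs \<nu> s m (i, j) \<noteq> 0" if "j \<in> {1..m}" for j
    using that by (intro bexI[of _ m]) (auto simp: eigvecs_last)
qed

lemma eigvecs_combine:
  assumes "has_eigvecs \<nu> s x m" "i \<in> {1..m}"
  shows "(\<Sum>k\<in>{1..m}. x (i, k) * (\<Sum>l\<in>{1..m}. eigvecs \<nu> s m (k, l) * u l))
       = (\<Sum>l\<in>{1..m}. eigvecs \<nu> s m (i, l) * (\<nu> (l, m) * u l))"
proof -
  have "(\<Sum>k\<in>{1..m}. x (i, k) * (\<Sum>l\<in>{1..m}. eigvecs \<nu> s m (k, l) * u l))
      = (\<Sum>l\<in>{1..m}. (\<Sum>k\<in>{1..m}. x (i, k) * eigvecs \<nu> s m (k, l)) * u l)"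
    by (simp add: sum_distrib_left sum_distrib_right mult.assoc) (rule sum.swap)
  also have "\<dots> = (\<Sum>l\<in>{1..m}. (\<nu> (l, m) * eigvecs \<nu> s m (i, l)) * u l)"
    by (intro sum.cong refl arg_cong2[where f = "(*)"]) (use assms in \<open>simp add: has_eigvecs_def\<close>)
  finally show ?thesis by (simp only: mult_ac)
qed

text \<open>Let \<open>\<mu> = \<nu> (j, Suc m)\<close> and
  \<open>u l = s (l, m) / (\<mu> - \<nu> (l, m))\<close>. In the eigenbasis of the smaller block the
  upper rows of the eigenvector equation read
  \<open>\<nu> (l, m) * u l + s (l, m) = \<mu> * u l\<close>, which holds by the choice of
  \<open>u\<close>; the last row is the hypothesis \<open>sum\<close>.\<close>

lemma has_eigvecs_Suc:
  assumes nu: "\<nu> \<in> e_Omega n" "Suc m \<le> n" and eig: "has_eigvecs \<nu> s x m"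
    and col: "\<And>i. i \<in> {1..m} \<Longrightarrow> x (i, Suc m) = (\<Sum>k\<in>{1..m}. eigvecs \<nu> s m (i, k) * s (k, m))"
    and sum: "\<And>j. j \<in> {1..Suc m} \<Longrightarrow>
      (\<Sum>k\<in>{1..m}. (\<Sum>i\<in>{1..m}. x (Suc m, i) * eigvecs \<nu> s m (i, k)) * s (k, m)
        / (\<nu> (j, Suc m) - \<nu> (k, m))) + x (Suc m, Suc m) = \<nu> (j, Suc m)"
  shows "has_eigvecs \<nu> s x (Suc m)"
  unfolding has_eigvecs_def
proof (intro ballI)
  fix i j assume i: "i \<in> {1..Suc m}" and j: "j \<in> {1..Suc m}"
  let ?G = "eigvecs \<nu> s m" and ?G' = "eigvecs \<nu> s (Suc m)"
  define u where "u k = s (k, m) / (\<nu> (j, Suc m) - \<nu> (k, m))" for k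
  have G': "?G' (k, j) = (\<Sum>l\<in>{1..m}. ?G (k, l) * u l)" if "k \<in> {1..m}" for k
    using that by (simp add: u_def)
  have split: "(\<Sum>k\<in>{1..Suc m}. x (i, k) * ?G' (k, j))
      = (\<Sum>k\<in>{1..m}. x (i, k) * (\<Sum>l\<in>{1..m}. ?G (k, l) * u l)) + x (i, Suc m)"
  proof -
    have "(\<Sum>k\<in>{1..m}. x (i, k) * ?G' (k, j)) = (\<Sum>k\<in>{1..m}. x (i, k) * (\<Sum>l\<in>{1..m}. ?G (k, l) * u l))"
      by (intro sum.cong refl arg_cong2[where f = "(*)"] G')
    then show ?thesis by (simp add: eigvecs_last del: eigvecs.simps)
  qed
  show "(\<Sum>k\<in>{1..Suc m}. x (i, k) * ?G' (k, j)) = \<nu> (j, Suc m) * ?G' (i, j)"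
  proof (cases "i = Suc m")
    case True
    have "(\<Sum>k\<in>{1..m}. x (i, k) * (\<Sum>l\<in>{1..m}. ?G (k, l) * u l))
        = (\<Sum>l\<in>{1..m}. (\<Sum>k\<in>{1..m}. x (i, k) * ?G (k, l)) * u l)"
      by (simp add: sum_distrib_left sum_distrib_right mult.assoc) (rule sum.swap)
    then show ?thesis
      unfolding split using sum[OF j] by (simp add: True eigvecs_last u_def del: eigvecs.simps)
  next
    case False
    then have im: "i \<in> {1..m}" using i by auto
    have "(\<Sum>k\<in>{1..m}. x (i, k) * (\<Sum>l\<in>{1..m}. ?G (k, l) * u l)) + x (i, Suc m)
       = (\<Sum>l\<in>{1..m}. ?G (i, l) * (\<nu> (l, m) * u l + s (l, m)))"
      unfolding eigvecs_combine[OF eig im] col[OF im] by (simp add: distrib_left sum.distrib)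
    also have "\<dots> = (\<Sum>l\<in>{1..m}. \<nu> (j, Suc m) * (?G (i, l) * u l))"
    proof (rule sum.cong[OF refl])
      fix l assume "l \<in> {1..m}"
      then have "\<nu> (l, m) \<noteq> \<nu> (j, Suc m)" using e_Omega_neq[OF nu _ j] by blast
      then have "s (l, m) = (\<nu> (j, Suc m) - \<nu> (l, m)) * u l" by (simp add: u_def)
      then show "?G (i, l) * (\<nu> (l, m) * u l + s (l, m)) = \<nu> (j, Suc m) * (?G (i, l) * u l)"
        by (simp add: algebra_simps)
    qed
    finally show ?thesis
      unfolding split G'[OF im] by (simp add: sum_distrib_left)
  qed
qed

lemma has_eigvecs_cong:
  assumes "\<And>i j. i \<in> {1..m} \<Longrightarrow> j \<in> {1..m} \<Longrightarrow> x (i, j) = y (i, j)"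
  shows "has_eigvecs \<nu> s x m \<longleftrightarrow> has_eigvecs \<nu> s y m"
  unfolding has_eigvecs_def using assms by simp

text \<open>The matrix is built by bordering: partial fractions supply the corner \<open>d\<close>
  and the products \<open>e k = c k * s (k, m)\<close>, and these give the last row because
  \<open>s\<close> has no zeros.\<close>

lemma ex_has_eigvecs:
  assumes nu: "\<nu> \<in> e_Omega n" and s: "\<And>i m. s (i, m) \<noteq> 0"
  shows "m \<le> n \<Longrightarrow> \<exists>x. \<forall>k\<le>m. has_eigvecs \<nu> s x k"
proof (induction m)
  case 0
  then show ?case by simp
next
  case (Suc m)
  then obtain x where x: "\<forall>k\<le>m. has_eigvecs \<nu> s x k" by auto
  let ?G = "eigvecs \<nu> s m"
  have det: "det (block m ?G) \<noteq> 0"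
    using nu Suc.prems x by (intro det_eigvecs_nonzero) auto
  have inj: "inj_on (\<lambda>i. \<nu> (i, m)) {1..m}" "inj_on (\<lambda>j. \<nu> (j, Suc m)) {1..Suc m}"
    using e_Omega_inj[OF nu] Suc.prems by simp_all
  obtain e d where ed: "\<forall>j\<in>{1..Suc m}.
      (\<Sum>i\<in>{1..m}. e i / (\<nu> (j, Suc m) - \<nu> (i, m))) + d = \<nu> (j, Suc m)"
    using partial_fraction_exists[OF inj e_Omega_neq[OF nu Suc.prems]] by blast
  define c where "c i = e i / s (i, m)" for i
  \<comment> \<open>The new row has product \<open>c k\<close> with the \<open>k\<close>-th column
    of \<open>?G\<close>, and the new column is \<open>?G\<close> applied to \<open>s\<close>. The
    other entries stay those of \<open>x\<close>, so the smaller blocks are unchanged.\<close>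
  define y where "y = (\<lambda>(i, j).
    if i = Suc m then if j = Suc m then d else \<Sum>k\<in>{1..m}. c k * inv_fun m ?G (k, j)
    else if j = Suc m then \<Sum>k\<in>{1..m}. ?G (i, k) * s (k, m) else x (i, j))"
  have y: "has_eigvecs \<nu> s y k" if "k \<le> m" for k
  proof -
    have "has_eigvecs \<nu> s y k \<longleftrightarrow> has_eigvecs \<nu> s x k"
      by (rule has_eigvecs_cong) (use that in \<open>auto simp: y_def\<close>)
    then show ?thesis using x that by simp
  qed
  have "has_eigvecs \<nu> s y (Suc m)"
  proof (rule has_eigvecs_Suc[OF nu Suc.prems y])
    fix j assume j: "j \<in> {1..Suc m}"
    have "(\<Sum>i\<in>{1..m}. y (Suc m, i) * ?G (i, k)) * s (k, m) = e k" if "k \<in> {1..m}" for k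
    proof -
      have "(\<Sum>i\<in>{1..m}. y (Suc m, i) * ?G (i, k))
          = (\<Sum>i\<in>{1..m}. (\<Sum>k\<in>{1..m}. c k * inv_fun m ?G (k, i)) * ?G (i, k))"
        by (intro sum.cong refl) (simp add: y_def)
      also have "\<dots> = c k" by (rule inv_fun_solve_left[OF det that])
      finally show ?thesis using s by (simp add: c_def)
    qed
    then show "(\<Sum>k\<in>{1..m}. (\<Sum>i\<in>{1..m}. y (Suc m, i) * ?G (i, k)) * s (k, m)
        / (\<nu> (j, Suc m) - \<nu> (k, m))) + y (Suc m, Suc m) = \<nu> (j, Suc m)"
      using bspec[OF ed j] by (simp add: y_def)
  qed (auto simp: y_def)
  with y show ?case by (metis le_Suc_eq)
qed

text \<open>Converse of the bordering step: \<open>s\<close> is read off from the last column of the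
  larger block in the eigenbasis of the smaller one. The given eigenvalues then satisfy the rational
  equation of \<open>has_eigvecs_Suc\<close>, and \<open>partial_fraction_nonzero\<close> excludes
  zeros of \<open>s\<close>.\<close>

lemma has_eigvecs_ex_coordinates:
  assumes nu: "\<nu> \<in> e_Omega n" "Suc m \<le> n"
    and eig: "has_eigvecs \<nu> s x m"
    and ev: "\<And>j. j \<in> {1..Suc m} \<Longrightarrow> \<nu> (j, Suc m) \<in> spectrum (block (Suc m) x)"
    and b: "\<And>k. k \<in> {1..m} \<Longrightarrow>
      s (k, m) = (\<Sum>i\<in>{1..m}. inv_fun m (eigvecs \<nu> s m) (k, i) * x (i, Suc m))"
  shows "has_eigvecs \<nu> s x (Suc m) \<and> (\<forall>k\<in>{1..m}. s (k, m) \<noteq> 0)"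
proof -
  let ?G = "eigvecs \<nu> s m"
  have det: "det (block m ?G) \<noteq> 0"
    using nu eig by (intro det_eigvecs_nonzero) auto
  have col: "x (i, Suc m) = (\<Sum>k\<in>{1..m}. ?G (i, k) * s (k, m))" if "i \<in> {1..m}" for i
  proof -
    have "(\<Sum>k\<in>{1..m}. ?G (i, k) * s (k, m))
        = (\<Sum>k\<in>{1..m}. ?G (i, k) * (\<Sum>i\<in>{1..m}. inv_fun m ?G (k, i) * x (i, Suc m)))"
      by (intro sum.cong refl) (simp add: b)
    then show ?thesis using inv_fun_solve_right[OF det that, of "\<lambda>i. x (i, Suc m)"] by simp
  qed
  define c where "c k = (\<Sum>i\<in>{1..m}. x (Suc m, i) * ?G (i, k))" for k
  have sum: "(\<Sum>k\<in>{1..m}. c k * s (k, m) / (\<nu> (j, Suc m) - \<nu> (k, m))) + x (Suc m, Suc m) = \<nu> (j, Suc m)"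
    if j: "j \<in> {1..Suc m}" for j
  proof -
    let ?\<mu> = "\<nu> (j, Suc m)"
    obtain v where nz: "\<exists>i\<in>{1..Suc m}. v i \<noteq> 0"
      and v: "\<And>i. i \<in> {1..Suc m} \<Longrightarrow> (\<Sum>k\<in>{1..Suc m}. x (i, k) * v k) = ?\<mu> * v i"
      using ev[OF j] unfolding spectrum_def mem_Collect_eq eigenvalue_block_iff by blast
    \<comment> \<open>The coordinates of the upper part of the eigenvector \<open>v\<close> in the
      eigenbasis.\<close>
    define u where "u k = (\<Sum>i\<in>{1..m}. inv_fun m ?G (k, i) * v i)" for k
    have vu: "v i = (\<Sum>k\<in>{1..m}. ?G (i, k) * u k)" if "i \<in> {1..m}" for i
      unfolding u_def using inv_fun_solve_right[OF det that, of v] by simp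
    have vx: "(\<Sum>k\<in>{1..m}. x (i, k) * v k) = (\<Sum>k\<in>{1..m}. x (i, k) * (\<Sum>l\<in>{1..m}. ?G (k, l) * u l))" for i
      by (intro sum.cong refl) (simp add: vu)
    have ne: "\<nu> (k, m) \<noteq> ?\<mu>" if "k \<in> {1..m}" for k using e_Omega_neq[OF nu that j] .
    have uk: "(\<nu> (k, m) - ?\<mu>) * u k + s (k, m) * v (Suc m) = 0" if k: "k \<in> {1..m}" for k
    proof -
      \<comment> \<open>\<open>w\<close> is the coordinate vector of the upper part of
        \<open>x v - \<mu> v\<close>. That part vanishes, and inverting \<open>?G\<close> gives
        \<open>w = 0\<close>.\<close>
      define w where "w k = (\<nu> (k, m) - ?\<mu>) * u k + s (k, m) * v (Suc m)" for k
      have "(\<Sum>l\<in>{1..m}. ?G (i, l) * w l) = 0" if i: "i \<in> {1..m}" for i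
      proof -
        have "(\<Sum>l\<in>{1..m}. ?G (i, l) * (\<nu> (l, m) * u l))
            + (\<Sum>l\<in>{1..m}. ?G (i, l) * s (l, m)) * v (Suc m)
            = ?\<mu> * (\<Sum>l\<in>{1..m}. ?G (i, l) * u l)"
          using v[of i] i unfolding eigvecs_combine[OF eig i, symmetric] vx[symmetric] col[OF i, symmetric]
            vu[OF i, symmetric] by simp
        then show ?thesis
          unfolding w_def by (simp add: sum_distrib_left sum_distrib_right algebra_simps sum.distrib sum_subtractf)
      qed
      then have sm: "(\<Sum>i\<in>{1..m}. inv_fun m ?G (k, i) * (\<Sum>l\<in>{1..m}. ?G (i, l) * w l)) = 0"
        by simp
      have "(\<Sum>i\<in>{1..m}. inv_fun m ?G (k, i) * (\<Sum>l\<in>{1..m}. ?G (i, l) * w l))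
          = (\<Sum>l\<in>{1..m}. (\<Sum>i\<in>{1..m}. inv_fun m ?G (k, i) * ?G (i, l)) * w l)"
        by (simp add: sum_distrib_left sum_distrib_right mult.assoc) (rule sum.swap)
      also have "\<dots> = (\<Sum>l\<in>{1..m}. if l = k then w l else 0)"
        by (intro sum.cong refl) (simp only: inv_fun_sum(2)[OF det k], auto)
      also have "\<dots> = w k" using k by (simp add: sum.delta)
      finally show ?thesis using sm by (simp add: w_def)
    qed
    \<comment> \<open>Without a last entry, \<open>u\<close> would vanish because the blocks share
      no eigenvalue, and then \<open>v = 0\<close>. So the last row may be divided by
      \<open>v (Suc m)\<close>.\<close>
    have last: "v (Suc m) \<noteq> 0"
    proof
      assume v0: "v (Suc m) = 0"
      then have "u k = 0" if "k \<in> {1..m}" for k using uk[OF that] ne[OF that] by simp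
      then have "v i = 0" if "i \<in> {1..m}" for i using vu[OF that] by simp
      with nz v0 show False by (metis atLeastAtMost_iff le_Suc_eq)
    qed
    have u: "u k = v (Suc m) * (s (k, m) / (?\<mu> - \<nu> (k, m)))" if "k \<in> {1..m}" for k
      using uk[OF that] ne[OF that] by (simp add: field_simps)
    have "?\<mu> * v (Suc m) = (\<Sum>k\<in>{1..m}. x (Suc m, k) * (\<Sum>l\<in>{1..m}. ?G (k, l) * u l)) + x (Suc m, Suc m) * v (Suc m)"
      using v[of "Suc m"] unfolding vx[symmetric] by simp
    also have "(\<Sum>k\<in>{1..m}. x (Suc m, k) * (\<Sum>l\<in>{1..m}. ?G (k, l) * u l)) = (\<Sum>l\<in>{1..m}. c l * u l)"
      unfolding c_def by (simp add: sum_distrib_left sum_distrib_right mult.assoc) (rule sum.swap)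
    also have "\<dots> = (\<Sum>l\<in>{1..m}. c l * s (l, m) / (?\<mu> - \<nu> (l, m))) * v (Suc m)"
      unfolding sum_distrib_right by (intro sum.cong refl) (simp add: u)
    finally have "?\<mu> * v (Suc m)
        = ((\<Sum>l\<in>{1..m}. c l * s (l, m) / (?\<mu> - \<nu> (l, m))) + x (Suc m, Suc m)) * v (Suc m)"
      by (simp add: distrib_right)
    then show ?thesis using last by simp
  qed
  have inj: "inj_on (\<lambda>i. \<nu> (i, m)) {1..m}" "inj_on (\<lambda>j. \<nu> (j, Suc m)) {1..Suc m}"
    using e_Omega_inj[OF nu(1)] nu(2) by simp_all
  have "c k * s (k, m) \<noteq> 0" if "k \<in> {1..m}" for k
    by (rule partial_fraction_nonzero[where e = "\<lambda>k. c k * s (k, m)", OF inj e_Omega_neq[OF nu] sum that])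
  then have "s (k, m) \<noteq> 0" if "k \<in> {1..m}" for k using that by force
  moreover have "has_eigvecs \<nu> s x (Suc m)"
    using has_eigvecs_Suc[OF nu eig col] sum by (simp add: c_def)
  ultimately show ?thesis by blast
qed

text \<open>Induction on the block size, fixing column \<open>m\<close> of \<open>s\<close> when
  passing from size \<open>m\<close> to size \<open>m + 1\<close>.\<close>

lemma ex_coordinates:
  assumes z: "z \<in> M_Omega_e n"
  shows "m \<le> n \<Longrightarrow> \<exists>s. (\<forall>i k. s (i, k) \<noteq> 0) \<and> (\<forall>k\<le>m. has_eigvecs (z \<circ> Inl) s (z \<circ> Inr) k)"
proof (induction m)
  case 0
  show ?case by (rule exI[of _ "\<lambda>_. 1"]) simp
next
  case (Suc m)
  let ?\<nu> = "z \<circ> Inl" and ?x = "z \<circ> Inr"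
  obtain s where s: "\<forall>i k. s (i, k) \<noteq> 0" "\<forall>k\<le>m. has_eigvecs ?\<nu> s ?x k"
    using Suc.IH[OF Suc_leD[OF Suc.prems]] by blast
  have nu: "?\<nu> \<in> e_Omega n" and ev: "\<And>j. j \<in> {1..Suc m} \<Longrightarrow> ?\<nu> (j, Suc m) \<in> spectrum (block (Suc m) ?x)"
    using z Suc.prems by (auto simp: M_Omega_e_iff)
  define b where "b k = (\<Sum>i\<in>{1..m}. inv_fun m (eigvecs ?\<nu> s m) (k, i) * ?x (i, Suc m))" for k
  \<comment> \<open>The nonzero values of \<open>s\<close> are kept at all other indices, so that
    \<open>t\<close> is nonzero everywhere.\<close>
  define t where "t = (\<lambda>(i, k). if k = m \<and> i \<in> {1..m} then b i else s (i, k))"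
  have st: "eigvecs ?\<nu> t k = eigvecs ?\<nu> s k" if "k \<le> m" for k
    using that by (intro eigvecs_cong) (auto simp: t_def)
  have t: "has_eigvecs ?\<nu> t ?x k" if "k \<le> m" for k
    using s(2) that st[OF that] by (simp add: has_eigvecs_def)
  have step: "has_eigvecs ?\<nu> t ?x (Suc m) \<and> (\<forall>k\<in>{1..m}. t (k, m) \<noteq> 0)"
    by (rule has_eigvecs_ex_coordinates[OF nu Suc.prems t ev], unfold st[OF order_refl])
      (auto simp: t_def b_def)
  then have "t (i, k) \<noteq> 0" for i k
    using s(1) by (cases "k = m \<and> i \<in> {1..m}") (auto simp: t_def)
  with step t show ?case by (metis le_Suc_eq)
qed

section \<open>Simple eigenvalues as holomorphic functions\<close>

lemma permutes_upt_less: "p permutes {0..<k::nat} \<Longrightarrow> i < k \<Longrightarrow> p i < k"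
  using permutes_in_image[of p "{0..<k}" i] by simp

lemma continuous_on_det:
  fixes A :: "'a::topological_space \<Rightarrow> complex Matrix.mat"
  assumes "\<And>z. z \<in> S \<Longrightarrow> A z \<in> carrier_mat k k"
    and "\<And>i j. i < k \<Longrightarrow> j < k \<Longrightarrow> continuous_on S (\<lambda>z. A z $$ (i, j))"
  shows "continuous_on S (\<lambda>z. det (A z))"
proof -
  have "continuous_on S (\<lambda>z. \<Sum>p | p permutes {0..<k}. signof p * (\<Prod>i = 0..<k. A z $$ (i, p i)))"
    by (intro continuous_intros assms(2)) (auto intro: permutes_upt_less)
  then show ?thesis
    using det_def'[OF assms(1)] by (simp cong: continuous_on_cong)
qed

lemma holomorphic_on_det:
  fixes A :: "complex \<Rightarrow> complex Matrix.mat"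
  assumes "\<And>z. A z \<in> carrier_mat k k"
    and "\<And>i j. i < k \<Longrightarrow> j < k \<Longrightarrow> (\<lambda>z. A z $$ (i, j)) holomorphic_on S"
  shows "(\<lambda>z. det (A z)) holomorphic_on S"
  unfolding det_def'[OF assms(1)]
  by (intro holomorphic_intros assms(2)) (auto intro: permutes_upt_less)

lemma continuous_on_coordinate: "continuous_on S (\<lambda>x. x i)"
  by (rule continuous_on_product_then_coordinatewise[OF continuous_on_id])

lemma continuous_on_fun_upd:
  fixes z :: "'i \<Rightarrow> 'a::topological_space"
  shows "continuous_on S (\<lambda>w. z(c := w))"
proof (rule continuous_on_coordinatewise_then_product)
  fix k show "continuous_on S (\<lambda>w. (z(c := w)) k)" by (cases "k = c") auto
qed

lemma holomorphic_on_fun_upd: "(\<lambda>w. (z(c := w)) k) holomorphic_on S"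
  by (cases "k = c") auto

lemma uminus_char_matrix_block_index:
  "i < m \<Longrightarrow> j < m \<Longrightarrow>
     (- char_matrix (block m x) t) $$ (i, j) = (if i = j then t else 0) - x (Suc i, Suc j)"
  by (simp add: char_matrix_def block_def)

lemma continuous_on_char_poly_block:
  "continuous_on S (\<lambda>x. poly (char_poly (block m x)) t)"
  unfolding char_poly_matrix[OF block_carrier]
  by (rule continuous_on_det[where k = m])
    (auto simp: uminus_char_matrix_block_index intro!: continuous_intros continuous_on_coordinate)

lemma holomorphic_on_char_poly_block:
  "(\<lambda>w. poly (char_poly (block m (x(c := w)))) t) holomorphic_on S"
  unfolding char_poly_matrix[OF block_carrier]
proof (rule holomorphic_on_det[where k = m])
  fix i j assume ij: "i < m" "j < m"
  have "(\<lambda>w. (- char_matrix (block m (x(c := w))) t) $$ (i, j))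
      = (\<lambda>w. (if i = j then t else 0) - (x(c := w)) (Suc i, Suc j))"
    by (intro ext uminus_char_matrix_block_index ij)
  then show "(\<lambda>w. (- char_matrix (block m (x(c := w))) t) $$ (i, j)) holomorphic_on S"
    by (simp only:) (intro holomorphic_intros holomorphic_on_fun_upd)
qed auto

text \<open>A list records multiplicities, so there are exactly \<open>m\<close> factors even if
  eigenvalues coincide.\<close>

lemma char_poly_eval_list:
  assumes "A \<in> carrier_mat m m"
  obtains as where "length as = m" "set as = spectrum A"
    "\<And>t. poly (char_poly A) t = (\<Prod>a\<leftarrow>as. t - a :: complex)"
proof -
  obtain as where as: "char_poly A = (\<Prod>a\<leftarrow>as. [:- a, 1:])" "length as = m"
    using char_poly_factorized[OF assms] by blast
  have ev: "poly (char_poly A) t = (\<Prod>a\<leftarrow>as. t - a)" for t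
    unfolding as(1) by (simp add: poly_prod_list o_def)
  have "set as = spectrum A"
    unfolding spectrum_root_char_poly[OF assms] ev by (auto simp: prod_list_zero_iff)
  with as(2) ev show ?thesis by (intro that)
qed

text \<open>If all \<open>m\<close> linear factors had absolute value at least
  \<open>\<epsilon>\<close>, so would their product be at least
  \<open>\<epsilon> ^ m\<close>.\<close>

lemma eigenvalue_near:
  fixes A :: "complex Matrix.mat"
  assumes "A \<in> carrier_mat m m" "norm (poly (char_poly A) t) < \<epsilon> ^ m" "\<epsilon> > 0"
  shows "\<exists>r\<in>spectrum A. norm (r - t) < \<epsilon>"
proof (rule ccontr)
  assume far: "\<not> ?thesis"
  obtain as where as: "length as = m" "set as = spectrum A"
    "\<And>t. poly (char_poly A) t = (\<Prod>a\<leftarrow>as. t - a :: complex)"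
    using char_poly_eval_list[OF assms(1)] by blast
  have "\<epsilon> ^ length bs \<le> norm (\<Prod>a\<leftarrow>bs. t - a)" if "\<forall>a\<in>set bs. norm (a - t) \<ge> \<epsilon>" for bs
    using that
  proof (induction bs)
    case (Cons b bs)
    then have "\<epsilon> * \<epsilon> ^ length bs \<le> norm (t - b) * norm (\<Prod>a\<leftarrow>bs. t - a)"
      using assms(3) by (intro mult_mono) (auto simp: norm_minus_commute)
    then show ?case by (simp add: norm_mult)
  qed simp
  then show False
    using far as assms(2) by (metis leD not_less)
qed

lemma char_poly_block_eval:
  assumes "inj_on l {1..m}" "l ` {1..m} = spectrum (block m x)"
  shows "poly (char_poly (block m x)) t = (\<Prod>i\<in>{1..m}. t - l i)"
proof -
  obtain as where as: "length as = m" "set as = spectrum (block m x)"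
    "\<And>t. poly (char_poly (block m x)) t = (\<Prod>a\<leftarrow>as. t - a)"
    using char_poly_eval_list[OF block_carrier] by blast
  have "card (set as) = length as"
    unfolding as(1,2) assms(2)[symmetric] using card_image[OF assms(1)] by simp
  then have "distinct as" by (rule card_distinct)
  then have "(\<Prod>a\<leftarrow>as. t - a) = (\<Prod>a\<in>l ` {1..m}. t - a)"
    unfolding assms(2) as(2)[symmetric] by (simp add: prod.distinct_set_conv_list)
  also have "\<dots> = (\<Prod>i\<in>{1..m}. t - l i)"
    by (rule prod.reindex_cong[OF assms(1)]) simp_all
  finally show ?thesis using as(3) by simp
qed

section \<open>Eigenvalues near separated points\<close>

text \<open>Stated by values of the characteristic polynomial, which makes openness immediate;
  \<open>eigenvalue_near\<close> turns it into closeness of eigenvalues.\<close>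

definition near_spectrum :: "nat \<Rightarrow> real \<Rightarrow> (nat \<Rightarrow> complex) \<Rightarrow> (nat \<times> nat \<Rightarrow> complex) set" where
  "near_spectrum m \<epsilon> a = {x. \<forall>i\<in>{1..m}. norm (poly (char_poly (block m x)) (a i)) < \<epsilon> ^ m}"

definition eig_near :: "nat \<Rightarrow> real \<Rightarrow> complex \<Rightarrow> (nat \<times> nat \<Rightarrow> complex) \<Rightarrow> complex" where
  "eig_near m \<epsilon> l x = (THE r. r \<in> spectrum (block m x) \<and> norm (r - l) < \<epsilon>)"

text \<open>The gap \<open>2 * \<epsilon>\<close> makes the open discs of radius
  \<open>\<epsilon>\<close> about the points disjoint.\<close>

definition separated :: "nat \<Rightarrow> real \<Rightarrow> (nat \<Rightarrow> complex) \<Rightarrow> bool" where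
  "separated m \<epsilon> a \<longleftrightarrow> \<epsilon> > 0 \<and>
     (\<forall>i\<in>{1..m}. \<forall>j\<in>{1..m}. i \<noteq> j \<longrightarrow> 2 * \<epsilon> \<le> norm (a i - a j))"

lemma separatedD:
  assumes "separated m \<epsilon> a" "i \<in> {1..m}" "j \<in> {1..m}" "norm (r - a i) < \<epsilon>" "norm (r - a j) < \<epsilon>"
  shows "i = j"
proof (rule ccontr)
  assume "i \<noteq> j"
  then have "2 * \<epsilon> \<le> norm (a i - a j)" using assms by (simp add: separated_def)
  also have "\<dots> \<le> norm (r - a j) + norm (r - a i)"
    using norm_triangle_ineq4[of "r - a j" "r - a i"] by simp
  finally show False using assms by simp
qed

lemma open_near_spectrum: "open (near_spectrum m \<epsilon> a)"
proof -
  have "near_spectrum m \<epsilon> a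
      = (\<Inter>i\<in>{1..m}. {x. norm (poly (char_poly (block m x)) (a i)) < \<epsilon> ^ m})"
    by (auto simp: near_spectrum_def)
  also have "open \<dots>"
    by (intro open_INT ballI finite_atLeastAtMost open_Collect_less continuous_intros
        continuous_on_char_poly_block)
  finally show ?thesis .
qed

context
  fixes m :: nat and \<epsilon> :: real and a :: "nat \<Rightarrow> complex"
  assumes sep: "separated m \<epsilon> a"
begin

lemma separated_pos: "\<epsilon> > 0"
  using sep by (simp add: separated_def)

text \<open>Every disc contains an eigenvalue and the discs are disjoint. The \<open>m\<close>
  eigenvalues so obtained are all of them, since a spectrum in size \<open>m\<close> has at most
  \<open>m\<close> elements.\<close>

lemma ex_labelling_near:
  assumes x: "x \<in> near_spectrum m \<epsilon> a"
  obtains r where "inj_on r {1..m}" "r ` {1..m} = spectrum (block m x)"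
    "\<And>i. i \<in> {1..m} \<Longrightarrow> norm (r i - a i) < \<epsilon>"
proof -
  have "\<forall>i\<in>{1..m}. \<exists>r. r \<in> spectrum (block m x) \<and> norm (r - a i) < \<epsilon>"
  proof
    fix i assume "i \<in> {1..m}"
    then have "norm (poly (char_poly (block m x)) (a i)) < \<epsilon> ^ m"
      using x by (simp add: near_spectrum_def)
    from eigenvalue_near[OF block_carrier this separated_pos]
    show "\<exists>r. r \<in> spectrum (block m x) \<and> norm (r - a i) < \<epsilon>" by blast
  qed
  from bchoice[OF this] obtain r where r:
    "\<And>i. i \<in> {1..m} \<Longrightarrow> r i \<in> spectrum (block m x)" "\<And>i. i \<in> {1..m} \<Longrightarrow> norm (r i - a i) < \<epsilon>"
    by blast
  have inj: "inj_on r {1..m}"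
    using separatedD[OF sep] r(2) by (metis inj_onI)
  have "r ` {1..m} = spectrum (block m x)"
  proof (rule card_seteq)
    show "card (spectrum (block m x)) \<le> card (r ` {1..m})"
      using card_finite_spectrum(2)[OF block_carrier[of m x]] card_image[OF inj] by simp
  qed (use r(1) card_finite_spectrum(1)[OF block_carrier] in auto)
  with inj r(2) show ?thesis by (intro that)
qed

text \<open>Makes the description in \<open>eig_near\<close> unique: every eigenvalue is some
  \<open>s j\<close>, and disjointness of the discs forces \<open>j = i\<close>.\<close>

lemma eig_near_eqI:
  assumes x: "x \<in> near_spectrum m \<epsilon> a" and i: "i \<in> {1..m}"
    and r: "r \<in> spectrum (block m x)" "norm (r - a i) < \<epsilon>"
  shows "eig_near m \<epsilon> (a i) x = r"
proof -
  obtain s where s: "inj_on s {1..m}" "s ` {1..m} = spectrum (block m x)"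
    "\<And>i. i \<in> {1..m} \<Longrightarrow> norm (s i - a i) < \<epsilon>"
    using ex_labelling_near[OF x] by blast
  have uniq: "r' = s i" if r': "r' \<in> spectrum (block m x)" "norm (r' - a i) < \<epsilon>" for r'
  proof -
    obtain j where j: "j \<in> {1..m}" "r' = s j" using r'(1) s(2) by (metis imageE)
    with separatedD[OF sep i j(1) r'(2)] s(3) show ?thesis by simp
  qed
  show ?thesis
    unfolding eig_near_def using r uniq by (intro the_equality) auto
qed

lemma eig_near_props:
  assumes x: "x \<in> near_spectrum m \<epsilon> a"
  shows "i \<in> {1..m} \<Longrightarrow> eig_near m \<epsilon> (a i) x \<in> spectrum (block m x)"
    and "i \<in> {1..m} \<Longrightarrow> norm (eig_near m \<epsilon> (a i) x - a i) < \<epsilon>"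
    and "inj_on (\<lambda>i. eig_near m \<epsilon> (a i) x) {1..m}"
    and "(\<lambda>i. eig_near m \<epsilon> (a i) x) ` {1..m} = spectrum (block m x)"
proof -
  obtain s where s: "inj_on s {1..m}" "s ` {1..m} = spectrum (block m x)"
    "\<And>i. i \<in> {1..m} \<Longrightarrow> norm (s i - a i) < \<epsilon>"
    using ex_labelling_near[OF x] by blast
  have eq: "eig_near m \<epsilon> (a i) x = s i" if "i \<in> {1..m}" for i
    using s that by (intro eig_near_eqI[OF x that]) auto
  show "i \<in> {1..m} \<Longrightarrow> eig_near m \<epsilon> (a i) x \<in> spectrum (block m x)"
    unfolding s(2)[symmetric] by (simp add: eq)
  show "i \<in> {1..m} \<Longrightarrow> norm (eig_near m \<epsilon> (a i) x - a i) < \<epsilon>"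
    using s(3) by (simp add: eq)
  show "inj_on (\<lambda>i. eig_near m \<epsilon> (a i) x) {1..m}"
    using s(1) by (rule inj_on_cong[THEN iffD2, rotated]) (rule eq)
  show "(\<lambda>i. eig_near m \<epsilon> (a i) x) ` {1..m} = spectrum (block m x)"
    unfolding s(2)[symmetric] by (intro image_cong refl eq)
qed

text \<open>The argument of \<open>eigenvalue_near\<close> is repeated around the eigenvalue
  \<open>?l\<close> at \<open>y\<close>, where the characteristic polynomial vanishes, with an
  arbitrarily small radius.\<close>

lemma continuous_on_eig_near:
  assumes i: "i \<in> {1..m}"
  shows "continuous_on (near_spectrum m \<epsilon> a) (eig_near m \<epsilon> (a i))"
  unfolding continuous_on_def
proof
  fix y assume y: "y \<in> near_spectrum m \<epsilon> a"
  let ?l = "eig_near m \<epsilon> (a i) y"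
  have m: "m > 0" using i by simp
  show "(eig_near m \<epsilon> (a i) \<longlongrightarrow> ?l) (at y within near_spectrum m \<epsilon> a)"
  proof (rule tendstoI)
    fix e :: real assume e: "e > 0"
    \<comment> \<open>The bound \<open>e\<close> gives the estimate; the other bound keeps an
      eigenvalue within \<open>\<delta>\<close> of \<open>?l\<close> inside the disc about
      \<open>a i\<close>, so that it is the one selected by \<open>eig_near\<close>.\<close>
    define \<delta> where "\<delta> = min e (\<epsilon> - norm (?l - a i))"
    have \<delta>: "\<delta> > 0" using e eig_near_props(2)[OF y i] by (simp add: \<delta>_def)
    have zero: "poly (char_poly (block m y)) ?l = 0"
      using eig_near_props(1)[OF y i] unfolding spectrum_root_char_poly[OF block_carrier] by simp
    have "((\<lambda>x. poly (char_poly (block m x)) ?l) \<longlongrightarrow> poly (char_poly (block m y)) ?l)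
        (at y within near_spectrum m \<epsilon> a)"
      using continuous_on_char_poly_block y unfolding continuous_on_def by blast
    then have "\<forall>\<^sub>F x in at y within near_spectrum m \<epsilon> a.
        dist (poly (char_poly (block m x)) ?l) (poly (char_poly (block m y)) ?l) < \<delta> ^ m"
      by (rule tendstoD) (use \<delta> in simp)
    moreover have "\<forall>\<^sub>F x in at y within near_spectrum m \<epsilon> a. x \<in> near_spectrum m \<epsilon> a"
      by (simp add: eventually_at_topological) blast
    ultimately show "\<forall>\<^sub>F x in at y within near_spectrum m \<epsilon> a. dist (eig_near m \<epsilon> (a i) x) ?l < e"
    proof eventually_elim
      case (elim x)
      then have "norm (poly (char_poly (block m x)) ?l) < \<delta> ^ m" by (simp add: zero)
      from eigenvalue_near[OF block_carrier this \<delta>] obtain r where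
        r: "r \<in> spectrum (block m x)" "norm (r - ?l) < \<delta>" by blast
      have "norm (r - a i) \<le> norm (r - ?l) + norm (?l - a i)"
        using norm_triangle_ineq[of "r - ?l" "?l - a i"] by simp
      also have "\<dots> < \<epsilon>" using r(2) by (simp add: \<delta>_def)
      finally have "eig_near m \<epsilon> (a i) x = r" using elim(2) r(1) by (intro eig_near_eqI[OF _ i])
      then show ?case using r(2) by (simp add: \<delta>_def dist_norm)
    qed
  qed
qed

text \<open>
  With \<open>t = l\<^sub>i(w\<^sub>0)\<close>, evaluating the characteristic polynomial \<open>\<Prod>\<^sub>j (t - l\<^sub>j(w))\<close> expresses
  \<open>l\<^sub>i(w) - l\<^sub>i(w\<^sub>0)\<close> as a holomorphic function of \<open>w\<close> vanishing at \<open>w\<^sub>0\<close>, divided by a continuous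
  function that does not vanish there.
\<close>

lemma holomorphic_on_eig_near:
  assumes i: "i \<in> {1..m}"
  shows "(\<lambda>w. eig_near m \<epsilon> (a i) (z(c := w))) holomorphic_on {w. z(c := w) \<in> near_spectrum m \<epsilon> a}"
proof -
  let ?N = "{w. z(c := w) \<in> near_spectrum m \<epsilon> a}"
  define l where "l j w = eig_near m \<epsilon> (a j) (z(c := w))" for j w
  have "?N = (\<lambda>w. z(c := w)) -` near_spectrum m \<epsilon> a" by auto
  then have op: "open ?N"
    using open_vimage[OF open_near_spectrum continuous_on_fun_upd] by metis
  have cont: "continuous_on ?N (l j)" if "j \<in> {1..m}" for j
    unfolding l_def
    by (rule continuous_on_compose2[OF continuous_on_eig_near[OF that] continuous_on_fun_upd]) auto
  have "l i holomorphic_on ?N"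
    unfolding holomorphic_on_open[OF op]
  proof
    fix w0 assume w0: "w0 \<in> ?N"
    define t where "t = l i w0"
    define f where "f w = poly (char_poly (block m (z(c := w)))) t" for w
    define h where "h w = (\<Prod>j\<in>{1..m} - {i}. t - l j w)" for w
    have f: "f w = (t - l i w) * h w" if "w \<in> ?N" for w
    proof -
      have "f w = (\<Prod>j\<in>{1..m}. t - l j w)"
        unfolding f_def l_def using that by (intro char_poly_block_eval eig_near_props) auto
      then show ?thesis unfolding h_def using i by (simp add: prod.remove)
    qed
    have "f holomorphic_on UNIV"
      unfolding f_def by (rule holomorphic_on_char_poly_block)
    then obtain f' where f': "(f has_field_derivative f') (at w0)"
      by (metis holomorphic_onD UNIV_I field_differentiable_def)
    have inj: "inj_on (\<lambda>j. l j w0) {1..m}"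
      unfolding l_def using w0 by (intro eig_near_props) simp
    have "t - l j w0 \<noteq> 0" if "j \<in> {1..m} - {i}" for j
      using inj_on_contraD[OF inj _ i, of j] that by (auto simp: t_def)
    then have h0: "h w0 \<noteq> 0"
      unfolding h_def by (simp only: prod_zero_iff finite_Diff finite_atLeastAtMost) blast
    have "continuous_on ?N h"
      unfolding h_def by (intro continuous_intros cont) auto
    then have h: "(h \<longlongrightarrow> h w0) (at w0)"
      using op w0 by (metis continuous_on_eq_continuous_at isCont_def)
    have "((\<lambda>w. - ((f w - f w0) / (w - w0)) / h w) \<longlongrightarrow> - f' / h w0) (at w0)"
      using f' h h0 by (intro tendsto_intros) (simp_all add: has_field_derivative_iff)
    \<comment> \<open>Since \<open>f w0 = 0\<close>, this solves
      \<open>f w = (t - l i w) * h w\<close> for the difference quotient, where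
      \<open>h w \<noteq> 0\<close>.\<close>
    moreover have "\<forall>\<^sub>F w in at w0. - ((f w - f w0) / (w - w0)) / h w = (l i w - l i w0) / (w - w0)"
    proof -
      have "\<forall>\<^sub>F w in at w0. w \<in> ?N" using op w0 by (rule eventually_at_in_open')
      moreover have "\<forall>\<^sub>F w in at w0. h w \<noteq> 0"
        using h h0 by (rule tendsto_imp_eventually_ne)
      ultimately show ?thesis
      proof eventually_elim
        case (elim w)
        have "f w0 = 0" using f[OF w0] by (simp add: t_def)
        then have "- ((f w - f w0) / (w - w0)) / h w = - ((t - l i w) * h w / (w - w0)) / h w"
          using f[OF elim(1)] by simp
        also have "\<dots> = (l i w - t) / (w - w0)"
          using elim(2) by (cases "w = w0") (simp_all add: field_simps)
        finally show ?case by (simp add: t_def)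
      qed
    qed
    ultimately have "((\<lambda>w. (l i w - l i w0) / (w - w0)) \<longlongrightarrow> - f' / h w0) (at w0)"
      by (rule Lim_transform_eventually)
    then show "\<exists>f'. (l i has_field_derivative f') (at w0)"
      by (auto simp: has_field_derivative_iff)
  qed
  then show ?thesis unfolding l_def .
qed

end

section \<open>The analytic covering\<close>

lemma holo_fun_coordinate:
  assumes "openin (top_of_set (cspace I)) W"
  shows "holo_fun I W (\<lambda>z. z k)"
  unfolding holo_fun_def using assms
  by (intro conjI ballI continuous_on_coordinate holomorphic_on_fun_upd)

text \<open>Serves both the projection and the action of the group, whose components on the given
  index set are coordinates.\<close>

lemma holo_map_coordinates:
  assumes "X \<subseteq> cspace I" "Y \<subseteq> cspace J" "f ` X \<subseteq> Y"
    and "\<And>j. j \<in> J \<Longrightarrow> \<exists>k. \<forall>z\<in>X. f z j = z k"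
  shows "holo_map I J X Y f"
  unfolding holo_map_def
proof (intro conjI assms(1-3) ballI)
  fix j a assume j: "j \<in> J" and a: "a \<in> X"
  obtain k where "\<forall>z\<in>X. f z j = z k" using assms(4)[OF j] by blast
  then show "\<exists>W F. a \<in> W \<and> holo_fun I W F \<and> (\<forall>z\<in>X \<inter> W. f z j = F z)"
    using assms(1) a holo_fun_coordinate[OF openin_subtopology_self, of I k]
    by (intro exI[of _ "cspace I"] exI[of _ "\<lambda>z. z k"]) auto
qed

lemma finite_eig_index: "finite (eig_index n)"
  by (rule finite_subset[of _ "{1..n} \<times> {1..n}"]) (auto simp: eig_index_def)

lemma finite_spectrum_block: "finite (spectrum (block m x))"
  by (rule card_finite_spectrum(1)[OF block_carrier])

lemma M_Omega_e_subset_cspace: "M_Omega_e n \<subseteq> cspace (eig_index n <+> mat_index n)"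
proof
  fix z assume "z \<in> M_Omega_e n"
  then have "z \<circ> Inl \<in> cspace (eig_index n)" "z \<circ> Inr \<in> cspace (mat_index n)"
    by (simp_all add: M_Omega_e_iff e_Omega_def)
  then have "z i = 0" if "i \<notin> eig_index n <+> mat_index n" for i
    using that by (cases i) (auto simp: cspace_def)
  then show "z \<in> cspace (eig_index n <+> mat_index n)"
    by (simp add: cspace_def)
qed

lemma M_Omega_subset_cspace: "M_Omega n \<subseteq> cspace (mat_index n)"
  by (auto simp: M_Omega_def)

lemma holo_map_pi_map:
  assumes "X \<subseteq> M_Omega_e n" "Y \<subseteq> M_Omega n" "pi_map ` X \<subseteq> Y"
  shows "holo_map (eig_index n <+> mat_index n) (mat_index n) X Y pi_map"
proof (rule holo_map_coordinates)
  show "\<exists>k. \<forall>z\<in>X. pi_map z j = z k" for j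
    by (rule exI[of _ "Inr j"]) (simp add: pi_map_def)
qed (use assms M_Omega_e_subset_cspace M_Omega_subset_cspace in blast)+

text \<open>Any enumeration of each spectrum is a labelling; it is extended by 0 to lie in
  \<open>cspace\<close>.\<close>

lemma pi_map_surj: "pi_map ` M_Omega_e n = M_Omega n"
proof (intro equalityI subsetI)
  fix x assume "x \<in> pi_map ` M_Omega_e n"
  then show "x \<in> M_Omega n" using M_Omega_e_pi_map by blast
next
  fix x assume x: "x \<in> M_Omega n"
  have "\<exists>h. bij_betw h {1..m} (spectrum (block m x))" if "m \<in> {1..n}" for m
    using ex_bij_betw_nat_finite_1[OF finite_spectrum_block, of m x] x that
    by (simp add: M_Omega_def)
  then obtain h where h: "\<And>m. m \<in> {1..n} \<Longrightarrow> bij_betw (h m) {1..m} (spectrum (block m x))"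
    by metis
  define \<nu> where "\<nu> = (\<lambda>(i, m). if (i, m) \<in> eig_index n then h m i else 0)"
  have "case_sum \<nu> x \<in> M_Omega_e n"
  proof (rule M_Omega_eI[OF x])
    show "\<nu> \<in> cspace (eig_index n)" by (auto simp: \<nu>_def cspace_def)
    fix m assume m: "m \<in> {1..n}"
    have "(\<lambda>i. \<nu> (i, m)) ` {1..m} = h m ` {1..m}"
      by (rule image_cong) (use m in \<open>auto simp: \<nu>_def eig_index_def\<close>)
    then show "(\<lambda>i. \<nu> (i, m)) ` {1..m} = spectrum (block m x)"
      using h[OF m] by (simp add: bij_betw_def)
  qed
  moreover have "pi_map (case_sum \<nu> x) = x" by (simp add: pi_map_def case_sum_o_inj)
  ultimately show "x \<in> pi_map ` M_Omega_e n" by (metis image_eqI)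
qed

text \<open>Half the smallest distance between distinct points works for all sizes at once.\<close>

lemma ex_separation:
  fixes L :: "nat \<Rightarrow> complex set"
  assumes "\<And>m. finite (L m)"
  obtains \<epsilon> :: real where "\<epsilon> > 0"
    "\<And>m l l'. m \<in> {1..n} \<Longrightarrow> l \<in> L m \<Longrightarrow> l' \<in> L m \<Longrightarrow> l \<noteq> l' \<Longrightarrow> 2 * \<epsilon> \<le> norm (l - l')"
proof -
  define P where "P = (\<Union>m\<in>{1..n}. L m \<times> L m) - {p. fst p = snd p}"
  \<comment> \<open>The element 1 keeps \<open>D\<close> nonempty when there are no pairs of
    distinct points, as for \<open>n = 1\<close>.\<close>
  define D where "D = insert 1 ((\<lambda>p. norm (fst p - snd p)) ` P)"
  have fin: "finite D" unfolding D_def P_def using assms by simp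
  have pos: "d > 0" if "d \<in> D" for d using that by (auto simp: D_def P_def)
  have Min: "Min D \<in> D" using fin by (intro Min_in) (auto simp: D_def)
  show ?thesis
  proof (rule that[of "Min D / 2"])
    show "Min D / 2 > 0" using pos[OF Min] by simp
    fix m l l' assume "m \<in> {1..n}" "l \<in> L m" "l' \<in> L m" "l \<noteq> l'"
    then have "(l, l') \<in> P" by (auto simp: P_def)
    then have "norm (l - l') \<in> D" unfolding D_def by force
    then show "2 * (Min D / 2) \<le> norm (l - l')" using fin by simp
  qed
qed

section \<open>The sheets over a neighbourhood of a point \<open>x0\<close>\<close>

context
  fixes n :: nat and x0 :: "nat \<times> nat \<Rightarrow> complex" and \<epsilon> :: real
  assumes x0: "x0 \<in> M_Omega n" and eps: "\<epsilon> > 0"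
    and sep: "\<And>m l l'. m \<in> {1..n} \<Longrightarrow> l \<in> spectrum (block m x0) \<Longrightarrow> l' \<in> spectrum (block m x0)
      \<Longrightarrow> l \<noteq> l' \<Longrightarrow> 2 * \<epsilon> \<le> norm (l - l')"
begin

text \<open>The fibre over \<open>x0\<close>, given by its eigenvalue coordinates; it indexes the
  sheets.\<close>

definition labellings :: "(nat \<times> nat \<Rightarrow> complex) set" where
  "labellings = {\<nu>. case_sum \<nu> x0 \<in> M_Omega_e n}"

text \<open>Depends only on the spectra of \<open>x0\<close> and not on a labelling, so that all
  sheets lie over the same set.\<close>

definition base_nbhd :: "(nat \<times> nat \<Rightarrow> complex) set" where
  "base_nbhd = (\<Inter>m\<in>{1..n}. \<Inter>l\<in>spectrum (block m x0).
     {x. norm (poly (char_poly (block m x)) l) < \<epsilon> ^ m})"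

definition sheet :: "(nat \<times> nat \<Rightarrow> complex) \<Rightarrow> ((nat \<times> nat) + (nat \<times> nat) \<Rightarrow> complex) set" where
  "sheet \<nu> = M_Omega_e n \<inter> pi_map -` base_nbhd \<inter>
     (\<Inter>p\<in>eig_index n. {z. norm (z (Inl p) - \<nu> p) < \<epsilon>})"

text \<open>The inverse of the projection on the sheet of \<open>\<nu>\<close>; the value 0 off
  \<open>eig_index n\<close> places it in \<open>cspace\<close>.\<close>

definition lift :: "(nat \<times> nat \<Rightarrow> complex) \<Rightarrow> (nat \<times> nat \<Rightarrow> complex) \<Rightarrow>
    ((nat \<times> nat) + (nat \<times> nat) \<Rightarrow> complex)" where
  "lift \<nu> x = case_sum (\<lambda>p. if p \<in> eig_index n then eig_near (snd p) \<epsilon> (\<nu> p) x else 0) x"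

lemma labelling_spectrum:
  assumes "\<nu> \<in> labellings" "m \<in> {1..n}"
  shows "spectrum (block m x0) = (\<lambda>i. \<nu> (i, m)) ` {1..m}" "inj_on (\<lambda>i. \<nu> (i, m)) {1..m}"
  using M_Omega_e_spectrum[of "case_sum \<nu> x0" n m] assms
  by (simp_all add: labellings_def case_sum_o_inj)

lemma labelling_separated:
  assumes nu: "\<nu> \<in> labellings" and m: "m \<in> {1..n}"
  shows "separated m \<epsilon> (\<lambda>i. \<nu> (i, m))"
  unfolding separated_def
proof (intro conjI ballI impI eps)
  fix i j assume ij: "i \<in> {1..m}" "j \<in> {1..m}" "i \<noteq> j"
  show "2 * \<epsilon> \<le> norm (\<nu> (i, m) - \<nu> (j, m))"
  proof (rule sep[OF m])
    show "\<nu> (i, m) \<in> spectrum (block m x0)" "\<nu> (j, m) \<in> spectrum (block m x0)"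
      unfolding labelling_spectrum[OF nu m] using ij by blast+
    show "\<nu> (i, m) \<noteq> \<nu> (j, m)"
      using inj_on_contraD[OF labelling_spectrum(2)[OF nu m] ij(3,1,2)] .
  qed
qed

lemma base_nbhd_near:
  assumes nu: "\<nu> \<in> labellings" and m: "m \<in> {1..n}" and x: "x \<in> base_nbhd"
  shows "x \<in> near_spectrum m \<epsilon> (\<lambda>i. \<nu> (i, m))"
  using x m labelling_spectrum(1)[OF nu m] unfolding base_nbhd_def near_spectrum_def by force

lemma open_base_nbhd: "open base_nbhd"
  unfolding base_nbhd_def
  by (intro open_INT ballI finite_atLeastAtMost finite_spectrum_block open_Collect_less
      continuous_intros continuous_on_char_poly_block)

lemma x0_in_base_nbhd: "x0 \<in> base_nbhd"
  using eps unfolding base_nbhd_def spectrum_root_char_poly[OF block_carrier] by simp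

lemma openin_sheet: "openin (top_of_set (M_Omega_e n)) (sheet \<nu>)"
proof -
  have "open (pi_map -` base_nbhd)"
    unfolding pi_map_def
    by (rule open_vimage[OF open_base_nbhd])
      (auto simp: o_def intro!: continuous_on_coordinatewise_then_product continuous_on_coordinate)
  moreover have "open (\<Inter>p\<in>eig_index n. {z :: (nat \<times> nat) + (nat \<times> nat) \<Rightarrow> complex. norm (z (Inl p) - \<nu> p) < \<epsilon>})"
    by (intro open_INT ballI finite_eig_index open_Collect_less continuous_intros
        continuous_on_coordinate)
  ultimately show ?thesis
    unfolding sheet_def by (subst Int_assoc) (intro openin_open_Int open_Int)
qed

lemma lift_in_sheet:
  assumes nu: "\<nu> \<in> labellings" and x: "x \<in> M_Omega n" "x \<in> base_nbhd"
  shows "lift \<nu> x \<in> sheet \<nu>"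
proof -
  note near = base_nbhd_near[OF nu _ x(2)] and sepd = labelling_separated[OF nu]
  have "lift \<nu> x \<in> M_Omega_e n"
    unfolding lift_def
  proof (rule M_Omega_eI[OF x(1)])
    fix m assume m: "m \<in> {1..n}"
    have "(\<lambda>i. if (i, m) \<in> eig_index n then eig_near (snd (i, m)) \<epsilon> (\<nu> (i, m)) x else 0) ` {1..m}
        = (\<lambda>i. eig_near m \<epsilon> (\<nu> (i, m)) x) ` {1..m}"
      by (rule image_cong) (use m in \<open>auto simp: eig_index_def\<close>)
    also have "\<dots> = spectrum (block m x)"
      by (rule eig_near_props(4)[OF sepd[OF m] near[OF m]])
    finally show "(\<lambda>i. if (i, m) \<in> eig_index n then eig_near (snd (i, m)) \<epsilon> (\<nu> (i, m)) x else 0) ` {1..m}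
        = spectrum (block m x)" .
  qed (simp add: cspace_def)
  moreover have "norm (lift \<nu> x (Inl p) - \<nu> p) < \<epsilon>" if p: "p \<in> eig_index n" for p
  proof -
    obtain i m where im: "p = (i, m)" "m \<in> {1..n}" "i \<in> {1..m}"
      using p by (auto simp: eig_index_def)
    from eig_near_props(2)[OF sepd[OF im(2)] near[OF im(2)] im(3)]
    show ?thesis using p by (simp add: lift_def im(1))
  qed
  moreover have "pi_map (lift \<nu> x) = x"
    by (simp add: pi_map_def lift_def case_sum_o_inj)
  ultimately show ?thesis using x(2) by (simp add: sheet_def)
qed

text \<open>The eigenvalue coordinate of \<open>z\<close> at \<open>(i, m)\<close> lies in the disc
  about \<open>\<nu> (i, m)\<close>, which contains only one eigenvalue of the block.\<close>

lemma lift_pi_map: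
  assumes nu: "\<nu> \<in> labellings" and z: "z \<in> sheet \<nu>"
  shows "lift \<nu> (pi_map z) = z"
proof
  fix p
  have zM: "z \<in> M_Omega_e n" and zT: "pi_map z \<in> base_nbhd"
    and zp: "\<And>p. p \<in> eig_index n \<Longrightarrow> norm (z (Inl p) - \<nu> p) < \<epsilon>"
    using z by (simp_all add: sheet_def)
  show "lift \<nu> (pi_map z) p = z p"
  proof (cases p)
    case (Inr q)
    then show ?thesis by (simp add: lift_def pi_map_def)
  next
    case (Inl q)
    show ?thesis
    proof (cases "q \<in> eig_index n")
      case False
      then have "p \<notin> eig_index n <+> mat_index n" using Inl by auto
      then have "z p = 0" using zM M_Omega_e_subset_cspace by (auto simp: cspace_def)
      then show ?thesis using False Inl by (simp add: lift_def)
    next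
      case True
      then obtain i m where im: "q = (i, m)" "m \<in> {1..n}" "i \<in> {1..m}"
        by (auto simp: eig_index_def)
      have "z (Inl (i, m)) \<in> spectrum (block m (pi_map z))"
        using zM im by (simp add: M_Omega_e_iff pi_map_def)
      from eig_near_eqI[OF labelling_separated[OF nu im(2)] base_nbhd_near[OF nu im(2) zT] im(3) this]
      show ?thesis using zp[OF True] True by (simp add: lift_def Inl im(1))
    qed
  qed
qed

lemma holo_fun_eig_near:
  assumes nu: "\<nu> \<in> labellings" and m: "m \<in> {1..n}" and i: "i \<in> {1..m}"
  shows "holo_fun J (cspace J \<inter> base_nbhd) (eig_near m \<epsilon> (\<nu> (i, m)))"
  unfolding holo_fun_def
proof (intro conjI ballI)
  note sepd = labelling_separated[OF nu m]
  have sub: "cspace J \<inter> base_nbhd \<subseteq> near_spectrum m \<epsilon> (\<lambda>i. \<nu> (i, m))"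
    using base_nbhd_near[OF nu m] by blast
  show "openin (top_of_set (cspace J)) (cspace J \<inter> base_nbhd)"
    by (rule openin_open_Int[OF open_base_nbhd])
  show "continuous_on (cspace J \<inter> base_nbhd) (eig_near m \<epsilon> (\<nu> (i, m)))"
    by (rule continuous_on_subset[OF continuous_on_eig_near[OF sepd i] sub])
  fix z c
  show "(\<lambda>w. eig_near m \<epsilon> (\<nu> (i, m)) (z(c := w))) holomorphic_on
      {w. z(c := w) \<in> cspace J \<inter> base_nbhd}"
    by (rule holomorphic_on_subset[OF holomorphic_on_eig_near[OF sepd i]]) (use sub in blast)
qed

lemma holo_map_lift:
  assumes nu: "\<nu> \<in> labellings"
  shows "holo_map (mat_index n) (eig_index n <+> mat_index n) (M_Omega n \<inter> base_nbhd) (sheet \<nu>) (lift \<nu>)"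
  unfolding holo_map_def
proof (intro conjI ballI)
  show "M_Omega n \<inter> base_nbhd \<subseteq> cspace (mat_index n)"
    using M_Omega_subset_cspace by blast
  show "sheet \<nu> \<subseteq> cspace (eig_index n <+> mat_index n)"
    using M_Omega_e_subset_cspace unfolding sheet_def by blast
  show "lift \<nu> ` (M_Omega n \<inter> base_nbhd) \<subseteq> sheet \<nu>"
    using lift_in_sheet[OF nu] by blast
  fix p a assume p: "p \<in> eig_index n <+> mat_index n" and a: "a \<in> M_Omega n \<inter> base_nbhd"
  then have a': "a \<in> cspace (mat_index n)" "a \<in> base_nbhd"
    using M_Omega_subset_cspace by auto
  show "\<exists>W F. a \<in> W \<and> holo_fun (mat_index n) W F \<and> (\<forall>z\<in>M_Omega n \<inter> base_nbhd \<inter> W. lift \<nu> z p = F z)"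
  proof (cases p)
    case (Inr q)
    show ?thesis
      using a' holo_fun_coordinate[OF openin_subtopology_self, of "mat_index n" q]
      by (intro exI[of _ "cspace (mat_index n)"] exI[of _ "\<lambda>z. z q"]) (auto simp: lift_def Inr)
  next
    case (Inl q)
    then have q: "q \<in> eig_index n" using p by auto
    then obtain i m where im: "q = (i, m)" "m \<in> {1..n}" "i \<in> {1..m}"
      by (auto simp: eig_index_def)
    show ?thesis
      using a' holo_fun_eig_near[OF nu im(2,3)] q
      by (intro exI[of _ "cspace (mat_index n) \<inter> base_nbhd"] exI[of _ "eig_near m \<epsilon> (\<nu> (i, m))"])
        (auto simp: lift_def Inl im(1))
  qed
qed

lemma biholomorphism_sheet:
  assumes nu: "\<nu> \<in> labellings"
  shows "biholomorphism (eig_index n <+> mat_index n) (mat_index n)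
    (sheet \<nu>) (M_Omega n \<inter> base_nbhd) pi_map (lift \<nu>)"
  unfolding biholomorphism_def
proof (intro conjI ballI)
  show "holo_map (eig_index n <+> mat_index n) (mat_index n) (sheet \<nu>) (M_Omega n \<inter> base_nbhd) pi_map"
    using M_Omega_e_pi_map by (intro holo_map_pi_map) (auto simp: sheet_def)
  show "pi_map (lift \<nu> x) = x" for x
    by (simp add: pi_map_def lift_def case_sum_o_inj)
qed (use holo_map_lift[OF nu] lift_pi_map[OF nu] in blast)+

text \<open>A common point lies within \<open>\<epsilon>\<close> of both labels, while distinct
  eigenvalues of \<open>x0\<close> in the same size are at least \<open>2 * \<epsilon>\<close>
  apart.\<close>

lemma disjoint_sheets:
  assumes nu: "\<nu> \<in> labellings" "\<mu> \<in> labellings" and z: "z \<in> sheet \<nu>" "z \<in> sheet \<mu>"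
  shows "\<nu> = \<mu>"
proof
  fix p show "\<nu> p = \<mu> p"
  proof (cases "p \<in> eig_index n")
    case False
    have "\<nu> \<in> cspace (eig_index n)" "\<mu> \<in> cspace (eig_index n)"
      using nu by (simp_all add: labellings_def M_Omega_e_iff e_Omega_def case_sum_o_inj)
    then show ?thesis using False by (cases p) (simp add: cspace_def)
  next
    case True
    then obtain i m where im: "p = (i, m)" "m \<in> {1..n}" "i \<in> {1..m}"
      by (auto simp: eig_index_def)
    show ?thesis
    proof (rule ccontr)
      assume ne: "\<nu> p \<noteq> \<mu> p"
      have "\<nu> p \<in> spectrum (block m x0)"
        unfolding labelling_spectrum(1)[OF nu(1) im(2)] im(1) using im(3) by blast
      moreover have "\<mu> p \<in> spectrum (block m x0)"
        unfolding labelling_spectrum(1)[OF nu(2) im(2)] im(1) using im(3) by blast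
      ultimately have "2 * \<epsilon> \<le> norm (\<nu> p - \<mu> p)" using sep[OF im(2)] ne by blast
      also have "\<dots> \<le> norm (z (Inl p) - \<mu> p) + norm (z (Inl p) - \<nu> p)"
        using norm_triangle_ineq4[of "z (Inl p) - \<mu> p" "z (Inl p) - \<nu> p"] by simp
      also have "\<dots> < 2 * \<epsilon>"
        using z True by (force simp: sheet_def)
      finally show False by simp
    qed
  qed
qed

lemma labellings_nonempty: "labellings \<noteq> {}"
proof -
  obtain z where z: "z \<in> M_Omega_e n" "pi_map z = x0"
    using x0 pi_map_surj by (metis imageE)
  have "case_sum (z \<circ> Inl) x0 = z"
    unfolding z(2)[symmetric] by (auto simp: fun_eq_iff pi_map_def split: sum.split)
  then have "z \<circ> Inl \<in> labellings" using z(1) by (simp add: labellings_def)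
  then show ?thesis by blast
qed

text \<open>Every eigenvalue coordinate of \<open>z\<close> is labelled by an eigenvalue of
  \<open>x0\<close> near it. Each disc holds one eigenvalue of the block, so distinct coordinates
  get distinct labels, and the labels exhaust the spectrum.\<close>

lemma ex_sheet:
  assumes z: "z \<in> M_Omega_e n" and zT: "pi_map z \<in> base_nbhd"
  shows "\<exists>\<nu>\<in>labellings. z \<in> sheet \<nu>"
proof -
  \<comment> \<open>An arbitrary labelling, to number the discs around the eigenvalues of
    \<open>x0\<close>; the labelling of the sheet through \<open>z\<close> is \<open>\<mu>\<close>
    below.\<close>
  obtain \<nu> where nu: "\<nu> \<in> labellings" using labellings_nonempty by blast
  have ex: "\<exists>l. l \<in> spectrum (block m x0) \<and> norm (z (Inl (i, m)) - l) < \<epsilon>"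
    if m: "m \<in> {1..n}" and i: "i \<in> {1..m}" for i m
  proof -
    note near = labelling_separated[OF nu m] base_nbhd_near[OF nu m zT]
    have "z (Inl (i, m)) \<in> spectrum (block m (pi_map z))"
      using z m i by (simp add: M_Omega_e_iff pi_map_def)
    then obtain j where j: "j \<in> {1..m}" "z (Inl (i, m)) = eig_near m \<epsilon> (\<nu> (j, m)) (pi_map z)"
      unfolding eig_near_props(4)[OF near, symmetric] by blast
    have "\<nu> (j, m) \<in> spectrum (block m x0)"
      unfolding labelling_spectrum(1)[OF nu m] using j(1) by blast
    then show ?thesis
      using eig_near_props(2)[OF near j(1)] unfolding j(2) by blast
  qed
  define l where "l i m = (SOME l. l \<in> spectrum (block m x0) \<and> norm (z (Inl (i, m)) - l) < \<epsilon>)" for i m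
  have l: "l i m \<in> spectrum (block m x0)" "norm (z (Inl (i, m)) - l i m) < \<epsilon>"
    if "m \<in> {1..n}" "i \<in> {1..m}" for i m
    using someI_ex[OF ex[OF that]] by (simp_all only: l_def)
  define \<mu> where "\<mu> = (\<lambda>(i, m). if (i, m) \<in> eig_index n then l i m else 0)"
  have \<mu>: "\<mu> (i, m) = l i m" if "m \<in> {1..n}" "i \<in> {1..m}" for i m
    using that by (auto simp: \<mu>_def eig_index_def)
  have "case_sum \<mu> x0 \<in> M_Omega_e n"
  proof (rule M_Omega_eI[OF x0])
    show "\<mu> \<in> cspace (eig_index n)" by (auto simp: \<mu>_def cspace_def)
    fix m assume m: "m \<in> {1..n}"
    have zm: "z (Inl (i, m)) = eig_near m \<epsilon> (\<nu> (k, m)) (pi_map z)"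
      if "i \<in> {1..m}" "k \<in> {1..m}" "l i m = \<nu> (k, m)" for i k
    proof -
      have "z (Inl (i, m)) \<in> spectrum (block m (pi_map z))"
        using z m that(1) by (simp add: M_Omega_e_iff pi_map_def)
      from eig_near_eqI[OF labelling_separated[OF nu m] base_nbhd_near[OF nu m zT] that(2) this]
      show ?thesis using l(2)[OF m that(1)] that(3) by simp
    qed
    \<comment> \<open>Equal labels put both coordinates in one disc, so they coincide as
      eigenvalues, against the injectivity of the labelling in \<open>z\<close>.\<close>
    have inj: "inj_on (\<lambda>i. \<mu> (i, m)) {1..m}"
    proof (rule inj_onI)
      fix i j assume i: "i \<in> {1..m}" and j: "j \<in> {1..m}" and "\<mu> (i, m) = \<mu> (j, m)"
      then have eq: "l i m = l j m" using \<mu>[OF m] by simp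
      obtain k where k: "k \<in> {1..m}" "l i m = \<nu> (k, m)"
        using l(1)[OF m i] unfolding labelling_spectrum(1)[OF nu m] by blast
      have "z (Inl (i, m)) = z (Inl (j, m))"
        using zm[OF i k] zm[OF j k(1)] k(2) eq by simp
      then show "i = j"
        using inj_onD[OF M_Omega_e_spectrum(2)[OF z m]] i j by blast
    qed
    show "(\<lambda>i. \<mu> (i, m)) ` {1..m} = spectrum (block m x0)"
    proof (rule card_seteq[OF finite_spectrum_block])
      show "(\<lambda>i. \<mu> (i, m)) ` {1..m} \<subseteq> spectrum (block m x0)"
        using l(1)[OF m] \<mu>[OF m] by auto
      show "card (spectrum (block m x0)) \<le> card ((\<lambda>i. \<mu> (i, m)) ` {1..m})"
        using card_finite_spectrum(2)[OF block_carrier[of m x0]] card_image[OF inj] by simp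
    qed
  qed
  then have "\<mu> \<in> labellings" by (simp add: labellings_def)
  moreover have "z \<in> sheet \<mu>"
    unfolding sheet_def using z zT l(2) by (auto simp: \<mu>_def eig_index_def)
  ultimately show ?thesis by blast
qed

lemma evenly_covered:
  "\<exists>T. x0 \<in> T \<and> openin (top_of_set (M_Omega n)) T \<and>
     (\<exists>v. \<Union>v = M_Omega_e n \<inter> pi_map -` T \<and>
          (\<forall>u\<in>v. openin (top_of_set (M_Omega_e n)) u) \<and> pairwise disjnt v \<and>
          (\<forall>u\<in>v. \<exists>q. biholomorphism (eig_index n <+> mat_index n) (mat_index n) u T pi_map q))"
proof (intro exI conjI)
  let ?T = "M_Omega n \<inter> base_nbhd" and ?v = "sheet ` labellings"
  show "x0 \<in> ?T" using x0 x0_in_base_nbhd by simp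
  show "openin (top_of_set (M_Omega n)) ?T" by (rule openin_open_Int[OF open_base_nbhd])
  show "\<Union>?v = M_Omega_e n \<inter> pi_map -` ?T"
  proof (intro equalityI subsetI)
    fix z assume "z \<in> \<Union>?v"
    then show "z \<in> M_Omega_e n \<inter> pi_map -` ?T" using M_Omega_e_pi_map by (auto simp: sheet_def)
  next
    fix z assume "z \<in> M_Omega_e n \<inter> pi_map -` ?T"
    then show "z \<in> \<Union>?v" using ex_sheet by blast
  qed
  show "\<forall>u\<in>?v. openin (top_of_set (M_Omega_e n)) u" using openin_sheet by blast
  show "pairwise disjnt ?v" using disjoint_sheets unfolding pairwise_def disjnt_def by blast
  show "\<forall>u\<in>?v. \<exists>q. biholomorphism (eig_index n <+> mat_index n) (mat_index n) u ?T pi_map q"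
    using biholomorphism_sheet by blast
qed

end

lemma analytic_covering_pi_map:
  "analytic_covering (eig_index n <+> mat_index n) (mat_index n) (M_Omega_e n) pi_map (M_Omega n)"
  unfolding analytic_covering_def
proof (intro conjI ballI pi_map_surj)
  show "holo_map (eig_index n <+> mat_index n) (mat_index n) (M_Omega_e n) (M_Omega n) pi_map"
    by (rule holo_map_pi_map) (simp_all add: pi_map_surj)
  fix x assume x: "x \<in> M_Omega n"
  obtain \<epsilon> where "\<epsilon> > 0" "\<And>m l l'. m \<in> {1..n} \<Longrightarrow> l \<in> spectrum (block m x) \<Longrightarrow> l' \<in> spectrum (block m x)
      \<Longrightarrow> l \<noteq> l' \<Longrightarrow> 2 * \<epsilon> \<le> norm (l - l')"
    using ex_separation[of "\<lambda>m. spectrum (block m x)" n] finite_spectrum_block by blast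
  from evenly_covered[OF x this]
  show "\<exists>T. x \<in> T \<and> openin (top_of_set (M_Omega n)) T \<and>
     (\<exists>v. \<Union>v = M_Omega_e n \<inter> pi_map -` T \<and>
          (\<forall>u\<in>v. openin (top_of_set (M_Omega_e n)) u) \<and> pairwise disjnt v \<and>
          (\<forall>u\<in>v. \<exists>q. biholomorphism (eig_index n <+> mat_index n) (mat_index n) u T pi_map q))" .
qed

section \<open>Connectedness of the total space\<close>

text \<open>Entries of the adjugate are signed minors, hence polynomials in the entries of the
  matrix.\<close>

lemma continuous_on_inv_fun:
  fixes g :: "'a::topological_space \<Rightarrow> nat \<times> nat \<Rightarrow> complex"
  assumes cont: "\<And>i j. i \<in> {1..m} \<Longrightarrow> j \<in> {1..m} \<Longrightarrow> continuous_on S (\<lambda>z. g z (i, j))"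
    and det: "\<And>z. z \<in> S \<Longrightarrow> det (block m (g z)) \<noteq> 0"
    and ij: "i \<in> {1..m}" "j \<in> {1..m}"
  shows "continuous_on S (\<lambda>z. inv_fun m (g z) (i, j))"
proof -
  have entry: "continuous_on S (\<lambda>z. block m (g z) $$ (a, b))" if "a < m" "b < m" for a b
    unfolding block_index[OF that] using that by (intro cont) auto
  have minor: "continuous_on S (\<lambda>z. det (mat_delete (block m (g z)) (j - 1) (i - 1)))"
  proof (rule continuous_on_det[where k = "m - 1"])
    show "mat_delete (block m (g z)) (j - 1) (i - 1) \<in> carrier_mat (m - 1) (m - 1)" for z
      by (rule mat_delete_carrier[OF block_carrier])
    fix a b assume ab: "a < m - 1" "b < m - 1"
    have "mat_delete (block m (g z)) (j - 1) (i - 1) $$ (a, b)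
        = block m (g z) $$ (if a < j - 1 then a else Suc a, if b < i - 1 then b else Suc b)" for z
      using ab by (simp add: mat_delete_def block_def)
    then show "continuous_on S (\<lambda>z. mat_delete (block m (g z)) (j - 1) (i - 1) $$ (a, b))"
      by (simp only:) (rule entry, use ab in auto)
  qed
  have "adj_mat (block m (g z)) $$ (i - 1, j - 1)
      = (- 1) ^ (j - 1 + (i - 1)) * det (mat_delete (block m (g z)) (j - 1) (i - 1))" for z
  proof -
    have "dim_row (block m (g z)) = m" "dim_col (block m (g z)) = m" by (simp_all add: block_def)
    then show ?thesis using ij unfolding adj_mat_def cofactor_def by auto
  qed
  moreover have "continuous_on S (\<lambda>z. det (block m (g z)))"
    by (rule continuous_on_det[where k = m, OF block_carrier entry])
  ultimately show ?thesis
    unfolding inv_fun_def using det minor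
    by (auto intro!: continuous_on_divide continuous_on_mult continuous_on_const)
qed

section \<open>The parametrisation of the total space\<close>

text \<open>The product of \<open>e_Omega n\<close> with a torus having one nonzero coordinate for
  each pair of naturals.\<close>

definition params :: "nat \<Rightarrow> ((nat \<times> nat \<Rightarrow> complex) \<times> (nat \<times> nat \<Rightarrow> complex)) set" where
  "params n = {(\<nu>, s). \<nu> \<in> e_Omega n \<and> (\<forall>i m. s (i, m) \<noteq> 0)}"

text \<open>The matrix component is \<open>G D G^-1\<close>, with \<open>G\<close> the eigenvector
  matrix of size \<open>n\<close> and \<open>D\<close> the diagonal matrix of the
  \<open>\<nu> (k, n)\<close>. This closed form gives continuity in the parameters.\<close>

definition point_of ::
  "nat \<Rightarrow> (nat \<times> nat \<Rightarrow> complex) \<times> (nat \<times> nat \<Rightarrow> complex) \<Rightarrow> (nat \<times> nat) + (nat \<times> nat) \<Rightarrow> complex" where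
  "point_of n p = case_sum (fst p) (\<lambda>(i, j). if (i, j) \<in> mat_index n
     then \<Sum>k\<in>{1..n}. eigvecs (fst p) (snd p) n (i, k) * fst p (k, n) * inv_fun n (eigvecs (fst p) (snd p) n) (k, j)
     else 0)"

text \<open>\<open>X G = G D\<close> gives \<open>X = G D G^-1\<close>, so the parameters determine
  the matrix obtained by bordering, and \<open>point_of\<close> recovers it.\<close>

lemma has_eigvecs_entries:
  assumes nu: "\<nu> \<in> e_Omega n" and eig: "has_eigvecs \<nu> s x n" and ij: "i \<in> {1..n}" "j \<in> {1..n}"
  shows "(\<Sum>k\<in>{1..n}. eigvecs \<nu> s n (i, k) * \<nu> (k, n) * inv_fun n (eigvecs \<nu> s n) (k, j)) = x (i, j)"
proof -
  let ?G = "eigvecs \<nu> s n" and ?H = "inv_fun n (eigvecs \<nu> s n)"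
  have det: "det (block n ?G) \<noteq> 0" using nu eig by (intro det_eigvecs_nonzero) auto
  have "(\<Sum>k\<in>{1..n}. ?G (i, k) * \<nu> (k, n) * ?H (k, j))
      = (\<Sum>k\<in>{1..n}. (\<Sum>l\<in>{1..n}. x (i, l) * ?G (l, k)) * ?H (k, j))"
    using eig ij by (intro sum.cong refl) (simp add: has_eigvecs_def mult.commute)
  also have "\<dots> = (\<Sum>l\<in>{1..n}. x (i, l) * (\<Sum>k\<in>{1..n}. ?G (l, k) * ?H (k, j)))"
    by (simp add: sum_distrib_left sum_distrib_right mult.assoc) (rule sum.swap)
  also have "\<dots> = (\<Sum>l\<in>{1..n}. if l = j then x (i, l) else 0)"
    by (intro sum.cong refl) (simp only: inv_fun_sum(1)[OF det _ ij(2)], auto)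
  finally show ?thesis using ij by (simp add: sum.delta)
qed

lemma point_of_eq:
  assumes "\<nu> \<in> e_Omega n" "has_eigvecs \<nu> s x n" "x \<in> cspace (mat_index n)"
  shows "point_of n (\<nu>, s) = case_sum \<nu> x"
proof -
  have "(\<lambda>(i, j). if (i, j) \<in> mat_index n
     then \<Sum>k\<in>{1..n}. eigvecs \<nu> s n (i, k) * \<nu> (k, n) * inv_fun n (eigvecs \<nu> s n) (k, j)
     else 0) = x"
  proof (rule ext, clarify)
    fix i j show "(if (i, j) \<in> mat_index n
       then \<Sum>k\<in>{1..n}. eigvecs \<nu> s n (i, k) * \<nu> (k, n) * inv_fun n (eigvecs \<nu> s n) (k, j)
       else 0) = x (i, j)"
      using assms(3) has_eigvecs_entries[OF assms(1,2), of i j] by (auto simp: mat_index_def cspace_def)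
  qed
  then show ?thesis
    unfolding point_of_def fst_conv snd_conv by (rule arg_cong)
qed

lemma has_eigvecs_spectrum:
  assumes eig: "has_eigvecs \<nu> s x m" and j: "j \<in> {1..m}"
  shows "\<nu> (j, m) \<in> spectrum (block m x)"
  unfolding spectrum_def mem_Collect_eq eigenvalue_block_iff
proof (intro exI[of _ "\<lambda>i. eigvecs \<nu> s m (i, j)"] conjI bexI[of _ m])
  show "eigvecs \<nu> s m (m, j) \<noteq> 0" using j by (simp add: eigvecs_last)
qed (use eig j in \<open>auto simp: has_eigvecs_def\<close>)

text \<open>One inclusion is the construction \<open>ex_has_eigvecs\<close>, the other the existence
  of coordinates \<open>ex_coordinates\<close>.\<close>

lemma point_of_image: "point_of n ` params n = M_Omega_e n"
proof (intro equalityI subsetI)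
  fix z assume "z \<in> point_of n ` params n"
  then obtain \<nu> s where nu: "\<nu> \<in> e_Omega n" and s: "\<And>i m. s (i, m) \<noteq> 0" and z: "z = point_of n (\<nu>, s)"
    by (auto simp: params_def)
  obtain x where x: "\<forall>k\<le>n. has_eigvecs \<nu> s x k"
    using ex_has_eigvecs[of \<nu> n s n] nu s by blast
  \<comment> \<open>The construction leaves entries outside \<open>mat_index n\<close> open; cutting
    them off gives an element of \<open>cspace\<close>.\<close>
  define y where "y = (\<lambda>p. if p \<in> mat_index n then x p else 0)"
  have y: "has_eigvecs \<nu> s y k" if "k \<le> n" for k
  proof -
    have "has_eigvecs \<nu> s y k \<longleftrightarrow> has_eigvecs \<nu> s x k"
      by (rule has_eigvecs_cong) (use that in \<open>auto simp: y_def mat_index_def\<close>)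
    then show ?thesis using x that by simp
  qed
  have yc: "y \<in> cspace (mat_index n)" by (simp add: y_def cspace_def)
  have "z = case_sum \<nu> y" unfolding z using nu y yc by (intro point_of_eq) auto
  then show "z \<in> M_Omega_e n"
    using nu yc has_eigvecs_spectrum[OF y] by (simp add: M_Omega_e_iff case_sum_o_inj)
next
  fix z assume z: "z \<in> M_Omega_e n"
  obtain s where s: "\<forall>i k. s (i, k) \<noteq> 0" "\<forall>k\<le>n. has_eigvecs (z \<circ> Inl) s (z \<circ> Inr) k"
    using ex_coordinates[OF z order_refl] by blast
  have nu: "z \<circ> Inl \<in> e_Omega n" "z \<circ> Inr \<in> cspace (mat_index n)"
    using z by (simp_all add: M_Omega_e_iff)
  have "point_of n (z \<circ> Inl, s) = case_sum (z \<circ> Inl) (z \<circ> Inr)"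
    using nu s(2) by (intro point_of_eq) auto
  also have "\<dots> = z" by (auto simp: fun_eq_iff split: sum.split)
  finally have "z = point_of n (z \<circ> Inl, s)" by simp
  moreover have "(z \<circ> Inl, s) \<in> params n" using nu s(1) by (simp add: params_def)
  ultimately show "z \<in> point_of n ` params n" by (metis image_eqI)
qed

lemma continuous_on_fst_coordinate: "continuous_on S (\<lambda>p. fst p c)"
  by (rule continuous_on_product_then_coordinatewise[OF continuous_on_fst[OF continuous_on_id]])

lemma continuous_on_snd_coordinate: "continuous_on S (\<lambda>p. snd p c)"
  by (rule continuous_on_product_then_coordinatewise[OF continuous_on_snd[OF continuous_on_id]])

lemma continuous_on_eigvecs:
  "m \<le> n \<Longrightarrow> i \<in> {1..m} \<Longrightarrow> j \<in> {1..m} \<Longrightarrow>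
     continuous_on (params n) (\<lambda>p. eigvecs (fst p) (snd p) m (i, j))"
proof (induction m arbitrary: i j)
  case (Suc m)
  show ?case
  proof (cases "i = Suc m")
    case True
    then show ?thesis by simp
  next
    case False
    then have i: "i \<in> {1..m}" using Suc.prems by auto
    have "continuous_on (params n) (\<lambda>p. \<Sum>k\<in>{1..m}. eigvecs (fst p) (snd p) m (i, k)
        * (snd p (k, m) / (fst p (j, Suc m) - fst p (k, m))))"
    proof (intro continuous_on_sum continuous_on_mult continuous_on_divide continuous_on_diff
        continuous_on_fst_coordinate continuous_on_snd_coordinate ballI)
      fix k assume k: "k \<in> {1..m}"
      show "continuous_on (params n) (\<lambda>p. eigvecs (fst p) (snd p) m (i, k))"
        using Suc.prems by (intro Suc.IH i k) simp
      fix p assume "p \<in> params n"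
      then have "fst p \<in> e_Omega n" by (auto simp: params_def)
      from e_Omega_neq[OF this Suc.prems(1) k Suc.prems(3)]
      show "fst p (j, Suc m) - fst p (k, m) \<noteq> 0" by simp
    qed
    then show ?thesis using False by simp
  qed
qed simp

lemma continuous_on_point_of: "continuous_on (params n) (point_of n)"
proof (rule continuous_on_coordinatewise_then_product)
  fix q :: "(nat \<times> nat) + (nat \<times> nat)"
  show "continuous_on (params n) (\<lambda>p. point_of n p q)"
  proof (cases q)
    case (Inl c)
    then show ?thesis by (simp add: point_of_def continuous_on_fst_coordinate)
  next
    case (Inr c)
    obtain i j where c: "c = (i, j)" by (cases c)
    show ?thesis
    proof (cases "c \<in> mat_index n")
      case False
      then show ?thesis by (simp add: point_of_def Inr c)
    next
      case True
      then have ij: "i \<in> {1..n}" "j \<in> {1..n}" by (auto simp: c mat_index_def)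
      \<comment> \<open>Invertibility comes from the eigenvector property, hence the detour through
        a matrix \<open>x\<close> that has these eigenvectors.\<close>
      have det: "det (block n (eigvecs (fst p) (snd p) n)) \<noteq> 0" if "p \<in> params n" for p
      proof -
        obtain \<nu> s where p: "p = (\<nu>, s)" and nu: "\<nu> \<in> e_Omega n" and s: "\<And>i m. s (i, m) \<noteq> 0"
          using \<open>p \<in> params n\<close> by (auto simp: params_def)
        obtain x where "\<forall>k\<le>n. has_eigvecs \<nu> s x k"
          using ex_has_eigvecs[of \<nu> n s n] nu s by blast
        then show ?thesis using det_eigvecs_nonzero[OF nu order_refl] by (auto simp: p)
      qed
      have "continuous_on (params n) (\<lambda>p. \<Sum>k\<in>{1..n}. eigvecs (fst p) (snd p) n (i, k) * fst p (k, n)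
          * inv_fun n (eigvecs (fst p) (snd p) n) (k, j))"
        by (intro continuous_on_sum continuous_on_mult continuous_on_fst_coordinate
            continuous_on_inv_fun continuous_on_eigvecs[OF order_refl] det ij)
      then show ?thesis using True by (simp add: point_of_def Inr c)
    qed
  qed
qed

section \<open>Connectedness by complex lines in the parameter space\<close>

text \<open>An affine function of \<open>t\<close> that is nonzero at \<open>t = 0\<close> has at
  most one zero.\<close>

lemma countable_line_zeros:
  fixes u v :: complex
  assumes "u \<noteq> 0"
  shows "countable {t. (1 - t) * u + t * v = 0}"
proof (rule countable_subset)
  show "{t. (1 - t) * u + t * v = 0} \<subseteq> {u / (u - v)}"
  proof
    fix t assume "t \<in> {t. (1 - t) * u + t * v = 0}"
    then have t: "t * (u - v) = u" by (simp add: algebra_simps)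
    with assms have "u - v \<noteq> 0" by auto
    with t show "t \<in> {u / (u - v)}" by (simp add: field_simps)
  qed
qed simp

text \<open>
  A complex line through a point of \<open>params n\<close> leaves \<open>params n\<close> in countably many points only,
  and the complement of a countable set in \<open>\<complex>\<close> is connected.
\<close>

lemma connected_params: "connected (params n)"
  unfolding connected_iff_connected_component
proof (intro ballI)
  fix p q assume p: "p \<in> params n" and q: "q \<in> params n"
  \<comment> \<open>The complex line with \<open>L 0 = p\<close> and \<open>L 1 = q\<close>.\<close>
  define L where "L t = (\<lambda>i. (1 - t) * fst p i + t * fst q i, \<lambda>i. (1 - t) * snd p i + t * snd q i)" for t
  define B where "B = {t. L t \<notin> params n}"
  have "countable B"
  proof (rule countable_subset)
    \<comment> \<open>The zeros along the line of a quantity with value \<open>w\<close> at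
      \<open>p\<close> and \<open>w'\<close> at \<open>q\<close>. Quantities vanishing at
      \<open>p\<close>, such as differences with \<open>c = d\<close>, impose no condition and get
      the empty set; the index pairs are countable.\<close>
    let ?Z = "\<lambda>w w'. if w \<noteq> 0 then {t. (1 - t) * w + t * w' = 0} else {} :: complex set"
    let ?U = "(\<Union>c. ?Z (snd p c) (snd q c)) \<union>
       (\<Union>c. \<Union>d. ?Z (fst p c - fst p d) (fst q c - fst q d))"
    show "countable ?U"
      by (intro countable_Un countable_UN) (auto intro: countable_line_zeros)
    show "B \<subseteq> ?U"
    proof (rule subsetI, rule ccontr)
      fix t assume t: "t \<in> B" and U: "t \<notin> ?U"
      have ne: "fst (L t) c \<noteq> fst (L t) d" if "fst p c \<noteq> fst p d" for c d
      proof
        assume "fst (L t) c = fst (L t) d"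
        then have "(1 - t) * (fst p c - fst p d) + t * (fst q c - fst q d) = 0"
          by (simp add: L_def algebra_simps)
        moreover have "t \<notin> ?Z (fst p c - fst p d) (fst q c - fst q d)" using U by blast
        ultimately show False using that by simp
      qed
      have snd: "snd (L t) c \<noteq> 0" for c
      proof -
        have "snd p c \<noteq> 0" using p by (cases c) (auto simp: params_def)
        moreover have "t \<notin> ?Z (snd p c) (snd q c)" using U by blast
        ultimately show ?thesis by (simp add: L_def)
      qed
      have pe: "fst p \<in> e_Omega n" and qe: "fst q \<in> e_Omega n"
        using p q by (auto simp: params_def)
      have "fst (L t) \<in> e_Omega n"
        unfolding e_Omega_def
      proof (intro CollectI conjI ballI)
        show "fst (L t) \<in> cspace (eig_index n)"
          using pe qe by (auto simp: e_Omega_def cspace_def L_def)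
        show "inj_on (\<lambda>i. fst (L t) (i, m)) {1..m}" if m: "m \<in> {1..n}" for m
        proof (rule inj_onI, rule ccontr)
          fix i j assume ij: "i \<in> {1..m}" "j \<in> {1..m}" "i \<noteq> j"
            and eq: "fst (L t) (i, m) = fst (L t) (j, m)"
          have "inj_on (\<lambda>i. fst p (i, m)) {1..m}" using m by (intro e_Omega_inj[OF pe]) simp
          then have "fst p (i, m) \<noteq> fst p (j, m)" using inj_on_contraD[OF _ ij(3,1,2)] by blast
          then show False using ne eq by blast
        qed
        show "fst (L t) (i, m) \<noteq> fst (L t) (j, m + 1)"
          if "m \<in> {1..n - 1}" "i \<in> {1..m}" "j \<in> {1..m + 1}" for m i j
          using pe that by (intro ne) (simp add: e_Omega_def)
      qed
      then have "L t \<in> params n"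
        using snd by (cases "L t") (auto simp: params_def)
      then show False using t by (simp add: B_def)
    qed
  qed
  then have "connected (UNIV - B)"
    by (intro path_connected_imp_connected path_connected_complement_countable[unfolded Compl_eq_Diff_UNIV])
      simp_all
  moreover have "continuous_on (UNIV - B) L"
    unfolding L_def
    by (intro continuous_on_Pair continuous_on_coordinatewise_then_product continuous_intros)
  ultimately have "connected (L ` (UNIV - B))" by (rule connected_continuous_image[rotated])
  moreover have "L ` (UNIV - B) \<subseteq> params n" by (auto simp: B_def)
  moreover have "L 0 = p" "L 1 = q" by (simp_all add: L_def)
  then have "p \<in> L ` (UNIV - B)" "q \<in> L ` (UNIV - B)"
    using p q unfolding B_def by (metis DiffI UNIV_I image_eqI mem_Collect_eq)+
  ultimately show "connected_component (params n) p q"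
    unfolding connected_component_def by blast
qed

lemma connected_M_Omega_e: "connected (M_Omega_e n)"
  using connected_continuous_image[OF continuous_on_point_of connected_params] point_of_image by metis

text \<open>Supplies the base point at which deck transformations are compared with the group
  action.\<close>

lemma M_Omega_e_nonempty: "M_Omega_e n \<noteq> {}"
proof -
  \<comment> \<open>The offset \<open>m * Suc n\<close> exceeds the range of \<open>i\<close>, so
    the values of consecutive sizes lie in disjoint intervals.\<close>
  define \<nu> :: "nat \<times> nat \<Rightarrow> complex" where
    "\<nu> = (\<lambda>(i, m). if (i, m) \<in> eig_index n then of_nat (i + m * Suc n) else 0)"
  have \<nu>: "\<nu> (i, m) = of_nat (i + m * Suc n)" if "m \<in> {1..n}" "i \<in> {1..m}" for i m
    using that by (auto simp: \<nu>_def eig_index_def)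
  have "\<nu> \<in> e_Omega n"
    unfolding e_Omega_def
  proof (intro CollectI conjI ballI)
    show "\<nu> \<in> cspace (eig_index n)" by (auto simp: \<nu>_def cspace_def)
    show "inj_on (\<lambda>i. \<nu> (i, m)) {1..m}" if "m \<in> {1..n}" for m
      by (rule inj_onI) (simp only: \<nu>[OF that] of_nat_eq_iff add_right_cancel)
    show "\<nu> (i, m) \<noteq> \<nu> (j, m + 1)" if "m \<in> {1..n - 1}" "i \<in> {1..m}" "j \<in> {1..m + 1}" for m i j
    proof -
      have "i + m * Suc n < j + (m + 1) * Suc n" using that by auto
      moreover have "\<nu> (i, m) = of_nat (i + m * Suc n)" "\<nu> (j, m + 1) = of_nat (j + (m + 1) * Suc n)"
        using that by (intro \<nu>; auto)+
      ultimately show ?thesis by (simp only: of_nat_eq_iff)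
    qed
  qed
  then have "(\<nu>, \<lambda>_. 1) \<in> params n" by (simp add: params_def)
  then show ?thesis using point_of_image by blast
qed

section \<open>Deck transformations\<close>

text \<open>Near \<open>x\<close> each lift stays in the sheet of its value at \<open>x\<close>. In
  a common sheet \<open>p\<close> is injective, so the lifts agree; in different sheets, which are
  disjoint, they differ.\<close>

lemma covering_space_lifts_locally_agree:
  assumes cov: "covering_space c p S"
    and g: "continuous_on U g" "g ` U \<subseteq> c" and h: "continuous_on U h" "h ` U \<subseteq> c"
    and eq: "\<And>x. x \<in> U \<Longrightarrow> p (g x) = p (h x)" and x: "x \<in> U"
  shows "\<exists>N. openin (top_of_set U) N \<and> x \<in> N \<and> (\<forall>y\<in>N. g y = h y \<longleftrightarrow> g x = h x)"
proof -
  have "p (g x) \<in> S" using cov g(2) x by (auto simp: covering_space_def)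
  then obtain T v where T: "p (g x) \<in> T"
    and v: "\<Union>v = c \<inter> p -` T" "\<forall>u\<in>v. openin (top_of_set c) u" "pairwise disjnt v"
    and hom: "\<forall>u\<in>v. \<exists>q. homeomorphism u T p q"
    using cov unfolding covering_space_def by metis
  have "g x \<in> \<Union>v" "h x \<in> \<Union>v"
    unfolding v(1) using g(2) h(2) x T eq[OF x] by auto
  then obtain u w where u: "u \<in> v" "g x \<in> u" and w: "w \<in> v" "h x \<in> w" by blast
  define N where "N = (U \<inter> g -` u) \<inter> (U \<inter> h -` w)"
  have "openin (top_of_set U) N"
    unfolding N_def using g h u w v(2)
    by (intro openin_Int continuous_openin_preimage[where T = c]) auto
  moreover have "x \<in> N" using x u w by (simp add: N_def)
  moreover have "g y = h y \<longleftrightarrow> g x = h x" if y: "y \<in> N" for y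
  proof (cases "u = w")
    case True
    obtain q where q: "homeomorphism u T p q" using hom u(1) by blast
    have "a = b" if "a \<in> u" "b \<in> u" "p a = p b" for a b
      using that homeomorphism_apply1[OF q] by metis
    then show ?thesis using u(2) w(2) eq[OF x] eq[of y] y True by (auto simp: N_def)
  next
    case False
    then have "u \<inter> w = {}" using v(3) u(1) w(1) by (auto simp: pairwise_def disjnt_def)
    then show ?thesis using u(2) w(2) y by (auto simp: N_def)
  qed
  ultimately show ?thesis by blast
qed

text \<open>The library's \<open>covering_space_lift_unique\<close> demands a normed total space.\<close>

lemma covering_space_lifts_agree:
  assumes cov: "covering_space c p S"
    and g: "continuous_on U g" "g ` U \<subseteq> c" and h: "continuous_on U h" "h ` U \<subseteq> c"
    and eq: "\<And>x. x \<in> U \<Longrightarrow> p (g x) = p (h x)"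
    and U: "connected U" and a: "a \<in> U" "g a = h a" and x: "x \<in> U"
  shows "g x = h x"
proof -
  \<comment> \<open>With \<open>b = True\<close> the agreement set is open, with
    \<open>b = False\<close> its complement.\<close>
  have clopen: "openin (top_of_set U) {x \<in> U. (g x = h x) = b}" for b
    unfolding openin_subopen[of _ "{x \<in> U. (g x = h x) = b}"]
  proof
    fix y assume y: "y \<in> {x \<in> U. (g x = h x) = b}"
    then have "y \<in> U" by simp
    from covering_space_lifts_locally_agree[OF cov g h eq this]
    obtain N where N: "openin (top_of_set U) N" "y \<in> N" "\<forall>z\<in>N. g z = h z \<longleftrightarrow> g y = h y"
      by blast
    have "N \<subseteq> U" using openin_subset[OF N(1)] by simp
    then have "N \<subseteq> {x \<in> U. (g x = h x) = b}" using N(3) y by blast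
    with N(1,2) show "\<exists>N. openin (top_of_set U) N \<and> y \<in> N \<and> N \<subseteq> {x \<in> U. (g x = h x) = b}"
      by blast
  qed
  have "U - {x \<in> U. (g x = h x) = True} = {x \<in> U. (g x = h x) = False}" by auto
  then have "closedin (top_of_set U) {x \<in> U. (g x = h x) = True}"
    using clopen[of False] by (simp add: closedin_def)
  then have "{x \<in> U. (g x = h x) = True} = {} \<or> {x \<in> U. (g x = h x) = True} = U"
    using U clopen[of True] unfolding connected_clopen by blast
  then show ?thesis using a x by auto
qed

section \<open>The group action on the total space\<close>

lemma Sigma_carrierD:
  assumes "\<sigma> \<in> carrier (Sigma_group n)" "m \<in> {1..n}"
  shows "\<sigma> m permutes {1..m}"
proof -
  have "\<sigma> m \<in> carrier (sym_group m)"
    using assms unfolding Sigma_group_def carrier_product_group by (rule PiE_mem)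
  then show ?thesis by (simp add: sym_group_carrier)
qed

lemma group_Sigma_group: "group (Sigma_group n)"
  unfolding Sigma_group_def by (rule product_group) (rule sym_group_is_group)

lemma Sigma_mult_apply:
  "m \<in> {1..n} \<Longrightarrow> (\<sigma> \<otimes>\<^bsub>Sigma_group n\<^esub> \<tau>) m = \<sigma> m \<circ> \<tau> m"
  by (simp add: Sigma_group_def product_group_def sym_group_mult)

lemma Sigma_one_apply: "m \<in> {1..n} \<Longrightarrow> \<one>\<^bsub>Sigma_group n\<^esub> m = id"
  by (simp add: Sigma_group_def sym_group_one)

lemma Sigma_act_Inr [simp]: "Sigma_act n \<sigma> z (Inr p) = z (Inr p)"
  by (simp add: Sigma_act_def)

lemma Sigma_act_Inl:
  "Sigma_act n \<sigma> z (Inl (i, m)) = (if (i, m) \<in> eig_index n then z (Inl (inv' (\<sigma> m) i, m)) else 0)"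
  by (simp add: Sigma_act_def Sigma_act_eig_def)

lemma pi_map_Sigma_act [simp]: "pi_map (Sigma_act n \<sigma> z) = pi_map z"
  by (simp add: pi_map_def fun_eq_iff)

lemma inv_in_index:
  assumes "\<sigma> \<in> carrier (Sigma_group n)" "(i, m) \<in> eig_index n"
  shows "(inv' (\<sigma> m) i, m) \<in> eig_index n"
proof -
  have m: "m \<in> {1..n}" "i \<in> {1..m}" using assms(2) by (auto simp: eig_index_def)
  have "inv' (\<sigma> m) permutes {1..m}" by (intro permutes_inv Sigma_carrierD[OF assms(1) m(1)])
  then have "inv' (\<sigma> m) i \<in> {1..m}" using m(2) by (simp only: permutes_in_image)
  then show ?thesis using m by (simp add: eig_index_def)
qed

lemma Sigma_act_in_M_Omega_e:
  assumes s: "\<sigma> \<in> carrier (Sigma_group n)" and z: "z \<in> M_Omega_e n"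
  shows "Sigma_act n \<sigma> z \<in> M_Omega_e n"
  unfolding Sigma_act_def
proof (rule M_Omega_eI)
  show "z \<circ> Inr \<in> M_Omega n" using M_Omega_e_pi_map[OF z] by (simp add: pi_map_def)
  show "Sigma_act_eig n \<sigma> (z \<circ> Inl) \<in> cspace (eig_index n)"
    by (auto simp: cspace_def Sigma_act_eig_def)
  fix m assume m: "m \<in> {1..n}"
  have "(\<lambda>i. Sigma_act_eig n \<sigma> (z \<circ> Inl) (i, m)) ` {1..m} = (\<lambda>i. z (Inl (inv' (\<sigma> m) i, m))) ` {1..m}"
    by (rule image_cong) (use m in \<open>auto simp: Sigma_act_eig_def eig_index_def\<close>)
  also have "\<dots> = (\<lambda>j. z (Inl (j, m))) ` (inv' (\<sigma> m) ` {1..m})"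
    by (simp only: image_image)
  also have "inv' (\<sigma> m) ` {1..m} = {1..m}"
    by (intro permutes_image permutes_inv Sigma_carrierD[OF s m])
  also have "(\<lambda>j. z (Inl (j, m))) ` {1..m} = spectrum (block m (z \<circ> Inr))"
    by (rule M_Omega_e_spectrum(1)[OF z m, symmetric])
  finally show "(\<lambda>i. Sigma_act_eig n \<sigma> (z \<circ> Inl) (i, m)) ` {1..m} = spectrum (block m (z \<circ> Inr))" .
qed

lemma holo_map_Sigma_act:
  assumes "\<sigma> \<in> carrier (Sigma_group n)"
  shows "holo_map (eig_index n <+> mat_index n) (eig_index n <+> mat_index n)
    (M_Omega_e n) (M_Omega_e n) (Sigma_act n \<sigma>)"
proof (rule holo_map_coordinates)
  fix j assume j: "j \<in> eig_index n <+> mat_index n"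
  show "\<exists>k. \<forall>z\<in>M_Omega_e n. Sigma_act n \<sigma> z j = z k"
  proof (cases j)
    case (Inl c)
    obtain i m where c: "c = (i, m)" by (cases c)
    show ?thesis
      using j by (intro exI[of _ "Inl (inv' (\<sigma> m) i, m)"]) (auto simp: Inl c Sigma_act_Inl)
  next
    case (Inr c)
    show ?thesis by (rule exI[of _ "Inr c"]) (simp add: Inr)
  qed
qed (use M_Omega_e_subset_cspace Sigma_act_in_M_Omega_e[OF assms] in blast)+

text \<open>A left action: inversion reverses the order of the permutations, and substituting into
  the index reverses it again.\<close>

lemma Sigma_act_mult:
  assumes s: "\<sigma> \<in> carrier (Sigma_group n)" and t: "\<tau> \<in> carrier (Sigma_group n)"
  shows "Sigma_act n (\<sigma> \<otimes>\<^bsub>Sigma_group n\<^esub> \<tau>) z = Sigma_act n \<sigma> (Sigma_act n \<tau> z)"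
proof
  fix p show "Sigma_act n (\<sigma> \<otimes>\<^bsub>Sigma_group n\<^esub> \<tau>) z p = Sigma_act n \<sigma> (Sigma_act n \<tau> z) p"
  proof (cases p)
    case (Inl c)
    obtain i m where c: "c = (i, m)" by (cases c)
    show ?thesis
    proof (cases "(i, m) \<in> eig_index n")
      case True
      then have m: "m \<in> {1..n}" by (auto simp: eig_index_def)
      have "inv' (\<sigma> m \<circ> \<tau> m) = inv' (\<tau> m) \<circ> inv' (\<sigma> m)"
        by (intro o_inv_distrib permutes_bij[OF Sigma_carrierD[OF _ m]] s t)
      then show ?thesis
        using True inv_in_index[OF s True]
        by (simp only: Inl c Sigma_act_Inl Sigma_mult_apply[OF m]) simp
    qed (simp add: Inl c Sigma_act_Inl)
  qed simp
qed

lemma Sigma_act_one: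
  assumes "z \<in> M_Omega_e n"
  shows "Sigma_act n \<one>\<^bsub>Sigma_group n\<^esub> z = z"
proof
  fix p show "Sigma_act n \<one>\<^bsub>Sigma_group n\<^esub> z p = z p"
  proof (cases p)
    case (Inl c)
    obtain i m where c: "c = (i, m)" by (cases c)
    show ?thesis
    proof (cases "(i, m) \<in> eig_index n")
      case True
      then have m: "m \<in> {1..n}" by (auto simp: eig_index_def)
      show ?thesis using True by (simp add: Inl c Sigma_act_Inl Sigma_one_apply[OF m] del: One_nat_def)
    next
      case False
      then have "p \<notin> eig_index n <+> mat_index n" by (auto simp: Inl c)
      then have "z p = 0" using assms M_Omega_e_subset_cspace by (auto simp: cspace_def)
      then show ?thesis using False by (simp add: Inl c Sigma_act_Inl)
    qed
  qed simp
qed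

lemma Sigma_act_inv:
  assumes s: "\<sigma> \<in> carrier (Sigma_group n)" and z: "z \<in> M_Omega_e n"
  shows "Sigma_act n (inv\<^bsub>Sigma_group n\<^esub> \<sigma>) (Sigma_act n \<sigma> z) = z"
    and "Sigma_act n \<sigma> (Sigma_act n (inv\<^bsub>Sigma_group n\<^esub> \<sigma>) z) = z"
proof -
  interpret group "Sigma_group n" by (rule group_Sigma_group)
  have i: "inv\<^bsub>Sigma_group n\<^esub> \<sigma> \<in> carrier (Sigma_group n)" using s by simp
  show "Sigma_act n (inv\<^bsub>Sigma_group n\<^esub> \<sigma>) (Sigma_act n \<sigma> z) = z"
    unfolding Sigma_act_mult[OF i s, symmetric] l_inv[OF s] by (rule Sigma_act_one[OF z])
  show "Sigma_act n \<sigma> (Sigma_act n (inv\<^bsub>Sigma_group n\<^esub> \<sigma>) z) = z"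
    unfolding Sigma_act_mult[OF s i, symmetric] r_inv[OF s] by (rule Sigma_act_one[OF z])
qed

lemma homeomorphism_Sigma_act:
  assumes s: "\<sigma> \<in> carrier (Sigma_group n)"
  shows "homeomorphism (M_Omega_e n) (M_Omega_e n) (Sigma_act n \<sigma>)
    (Sigma_act n (inv\<^bsub>Sigma_group n\<^esub> \<sigma>))"
proof -
  have i: "inv\<^bsub>Sigma_group n\<^esub> \<sigma> \<in> carrier (Sigma_group n)"
    using group.inv_closed[OF group_Sigma_group s] .
  show ?thesis
    by (rule homeomorphismI)
      (use holo_map_Sigma_act[THEN holo_map_continuous_on] Sigma_act_in_M_Omega_e Sigma_act_inv s i in auto)
qed

text \<open>The eigenvalues in each size are distinct, so each permutation can be read off from its
  effect on a single point.\<close>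

lemma Sigma_act_free:
  assumes s: "\<sigma> \<in> carrier (Sigma_group n)" and t: "\<tau> \<in> carrier (Sigma_group n)"
    and z: "z \<in> M_Omega_e n" and eq: "Sigma_act n \<sigma> z = Sigma_act n \<tau> z"
  shows "\<sigma> = \<tau>"
proof (rule PiE_ext)
  \<comment> \<open>Elements of the product group are extensional, so agreement on
    \<open>{1..n}\<close> suffices.\<close>
  show "\<sigma> \<in> (\<Pi>\<^sub>E m\<in>{1..n}. carrier (sym_group m))" "\<tau> \<in> (\<Pi>\<^sub>E m\<in>{1..n}. carrier (sym_group m))"
    using s t by (simp_all add: Sigma_group_def)
  fix m assume m: "m \<in> {1..n}"
  note ps = Sigma_carrierD[OF s m] and pt = Sigma_carrierD[OF t m]
  have "inv' (\<sigma> m) i = inv' (\<tau> m) i" for i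
  proof (cases "i \<in> {1..m}")
    case True
    then have im: "(i, m) \<in> eig_index n" using m by (simp add: eig_index_def)
    have "z (Inl (inv' (\<sigma> m) i, m)) = z (Inl (inv' (\<tau> m) i, m))"
      using fun_cong[OF eq, of "Inl (i, m)"] im by (simp add: Sigma_act_Inl)
    moreover have "inv' (\<sigma> m) i \<in> {1..m}" "inv' (\<tau> m) i \<in> {1..m}"
      using inv_in_index[OF s im] inv_in_index[OF t im] by (simp_all add: eig_index_def)
    ultimately show ?thesis using inj_onD[OF M_Omega_e_spectrum(2)[OF z m]] by blast
  next
    case False
    then show ?thesis
      using permutes_not_in[OF permutes_inv[OF ps]] permutes_not_in[OF permutes_inv[OF pt]] by simp
  qed
  then have "inv' (\<sigma> m) = inv' (\<tau> m)" by (rule ext)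
  then have "inv' (inv' (\<sigma> m)) = inv' (inv' (\<tau> m))" by (rule arg_cong)
  then show "\<sigma> m = \<tau> m" by (simp only: permutes_inv_inv[OF ps] permutes_inv_inv[OF pt])
qed

lemma ex_relabelling:
  assumes "inj_on f A" "inj_on g A" "f ` A = g ` A"
  shows "\<exists>p. p permutes A \<and> (\<forall>i\<in>A. g i = f (p i))"
proof -
  define p where "p i = (if i \<in> A then inv_into A f (g i) else i)" for i
  have "bij_betw (inv_into A f \<circ> g) A A"
    using assms by (intro bij_betw_trans[of g A "f ` A"] bij_betw_inv_into inj_on_imp_bij_betw)
      (simp add: bij_betw_def)
  then have "bij_betw p A A"
    by (rule bij_betw_cong[THEN iffD1, rotated]) (simp add: p_def)
  then have "p permutes A" by (rule bij_imp_permutes) (simp add: p_def)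
  moreover have "g i = f (p i)" if "i \<in> A" for i
    using that assms(3) by (simp add: p_def f_inv_into_f)
  ultimately show ?thesis by blast
qed

text \<open>Points of one fibre label the same spectra injectively, so in each size their labellings
  differ by a permutation.\<close>

lemma Sigma_act_transitive:
  assumes z: "z \<in> M_Omega_e n" and w: "w \<in> M_Omega_e n" and eq: "pi_map z = pi_map w"
  shows "\<exists>\<sigma>\<in>carrier (Sigma_group n). Sigma_act n \<sigma> z = w"
proof -
  have x: "z \<circ> Inr = w \<circ> Inr" using eq by (simp add: pi_map_def)
  have "\<exists>p. p permutes {1..m} \<and> (\<forall>i\<in>{1..m}. w (Inl (i, m)) = z (Inl (p i, m)))" if m: "m \<in> {1..n}" for m
    using M_Omega_e_spectrum[OF z m] M_Omega_e_spectrum[OF w m] unfolding x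
    by (intro ex_relabelling) simp_all
  then obtain p where p: "\<And>m. m \<in> {1..n} \<Longrightarrow> p m permutes {1..m}"
    "\<And>m i. m \<in> {1..n} \<Longrightarrow> i \<in> {1..m} \<Longrightarrow> w (Inl (i, m)) = z (Inl (p m i, m))"
    by metis
  \<comment> \<open>The relabelling \<open>p m\<close> moves the index directly, whereas the action
    uses the inverse of \<open>\<sigma> m\<close>.\<close>
  define \<sigma> where "\<sigma> = (\<lambda>m\<in>{1..n}. inv' (p m))"
  have s: "\<sigma> \<in> carrier (Sigma_group n)"
    unfolding Sigma_group_def carrier_product_group \<sigma>_def
    by (rule restrict_PiE_iff[THEN iffD2]) (auto simp: sym_group_carrier simp del: One_nat_def intro!: permutes_inv p)
  have "Sigma_act n \<sigma> z q = w q" for q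
  proof (cases q)
    case (Inl c)
    obtain i m where c: "c = (i, m)" by (cases c)
    show ?thesis
    proof (cases "(i, m) \<in> eig_index n")
      case True
      then have m: "m \<in> {1..n}" "i \<in> {1..m}" by (auto simp: eig_index_def)
      have "inv' (\<sigma> m) = p m" using permutes_inv_inv[OF p(1)[OF m(1)]] m(1) by (simp add: \<sigma>_def)
      then show ?thesis using True p(2)[OF m] by (simp add: Inl c Sigma_act_Inl)
    next
      case False
      then have "q \<notin> eig_index n <+> mat_index n" by (auto simp: Inl c)
      then have "w q = 0" using w M_Omega_e_subset_cspace by (auto simp: cspace_def)
      then show ?thesis using False by (simp add: Inl c Sigma_act_Inl)
    qed
  next
    case (Inr c)
    then show ?thesis using fun_cong[OF x, of c] by simp
  qed
  with s show ?thesis by blast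
qed

section \<open>The isomorphism with the group of deck transformations\<close>

lemma Sigma_act_deck:
  assumes s: "\<sigma> \<in> carrier (Sigma_group n)"
  shows "restrict (Sigma_act n \<sigma>) (M_Omega_e n) \<in> carrier (deck_group (M_Omega_e n) pi_map)"
proof -
  let ?c = "M_Omega_e n" and ?f = "restrict (Sigma_act n \<sigma>) (M_Omega_e n)"
  have hom: "homeomorphism ?c ?c ?f (Sigma_act n (inv\<^bsub>Sigma_group n\<^esub> \<sigma>))"
    by (rule homeomorphism_cong[OF homeomorphism_Sigma_act[OF s]]) simp_all
  then have "bij_betw ?f ?c ?c"
    using homeomorphism_apply1[OF hom] homeomorphism_image1[OF hom]
    unfolding bij_betw_def by (metis inj_on_inverseI)
  with hom show ?thesis
    by (auto simp: deck_group_def Bij_def)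
qed

text \<open>By transitivity some \<open>\<sigma>\<close> agrees with \<open>f\<close> at a base
  point. Both are lifts of the projection on a connected space, so they agree everywhere.\<close>

lemma deck_eq_Sigma_act:
  assumes f: "f \<in> carrier (deck_group (M_Omega_e n) pi_map)"
  shows "\<exists>\<sigma>\<in>carrier (Sigma_group n). f = restrict (Sigma_act n \<sigma>) (M_Omega_e n)"
proof -
  let ?c = "M_Omega_e n"
  obtain g where ext: "f \<in> extensional ?c" and hom: "homeomorphism ?c ?c f g"
    and pi: "\<And>z. z \<in> ?c \<Longrightarrow> pi_map (f z) = pi_map z"
    using f by (auto simp: deck_group_def Bij_def)
  obtain a where a: "a \<in> ?c" using M_Omega_e_nonempty by blast
  have fc: "f ` ?c \<subseteq> ?c" using homeomorphism_image1[OF hom] by simp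
  have "f a \<in> ?c" using fc a by blast
  from Sigma_act_transitive[OF a this] obtain \<sigma>
    where s: "\<sigma> \<in> carrier (Sigma_group n)" "Sigma_act n \<sigma> a = f a"
    using pi[OF a] by auto
  have "f z = Sigma_act n \<sigma> z" if z: "z \<in> ?c" for z
  proof (rule covering_space_lifts_agree[where U = ?c and a = a and g = f and h = "Sigma_act n \<sigma>"])
    show "covering_space ?c pi_map (M_Omega n)"
      by (rule analytic_covering_imp_covering_space[OF analytic_covering_pi_map])
    show "continuous_on ?c f" by (rule homeomorphism_cont1[OF hom])
    show "continuous_on ?c (Sigma_act n \<sigma>)"
      by (rule holo_map_continuous_on[OF holo_map_Sigma_act[OF s(1)]])
    show "Sigma_act n \<sigma> ` ?c \<subseteq> ?c" using Sigma_act_in_M_Omega_e[OF s(1)] by blast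
  qed (use fc pi connected_M_Omega_e a s(2) z in auto)
  then have "f = restrict (Sigma_act n \<sigma>) ?c"
    using ext by (auto simp: extensional_def fun_eq_iff)
  with s(1) show ?thesis by blast
qed

lemma Sigma_act_iso_deck:
  "(\<lambda>\<sigma>. restrict (Sigma_act n \<sigma>) (M_Omega_e n)) \<in> iso (Sigma_group n) (deck_group (M_Omega_e n) pi_map)"
  (is "?F \<in> _")
proof (rule isoI)
  let ?c = "M_Omega_e n"
  show "?F \<in> hom (Sigma_group n) (deck_group ?c pi_map)"
  proof (rule homI)
    show "?F \<sigma> \<in> carrier (deck_group ?c pi_map)" if "\<sigma> \<in> carrier (Sigma_group n)" for \<sigma>
      by (rule Sigma_act_deck[OF that])
    fix \<sigma> \<tau> assume st: "\<sigma> \<in> carrier (Sigma_group n)" "\<tau> \<in> carrier (Sigma_group n)"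
    \<comment> \<open>The multiplication of \<open>BijGroup\<close> is composition only for
      arguments in \<open>Bij\<close>.\<close>
    have "?F \<sigma> \<in> Bij ?c" "?F \<tau> \<in> Bij ?c"
      using Sigma_act_deck[OF st(1)] Sigma_act_deck[OF st(2)] by (simp_all add: deck_group_def)
    then have "?F \<sigma> \<otimes>\<^bsub>deck_group ?c pi_map\<^esub> ?F \<tau> = compose ?c (?F \<sigma>) (?F \<tau>)"
      by (simp add: deck_group_def BijGroup_def)
    also have "\<dots> = ?F (\<sigma> \<otimes>\<^bsub>Sigma_group n\<^esub> \<tau>)"
      using Sigma_act_in_M_Omega_e[OF st(2)] by (auto simp: compose_def fun_eq_iff Sigma_act_mult[OF st])
    finally show "?F (\<sigma> \<otimes>\<^bsub>Sigma_group n\<^esub> \<tau>) = ?F \<sigma> \<otimes>\<^bsub>deck_group ?c pi_map\<^esub> ?F \<tau>" by simp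
  qed
  show "bij_betw ?F (carrier (Sigma_group n)) (carrier (deck_group ?c pi_map))"
    unfolding bij_betw_def
  proof (intro conjI equalityI subsetI)
    \<comment> \<open>One point decides injectivity, because the action is free.\<close>
    obtain a where a: "a \<in> ?c" using M_Omega_e_nonempty by blast
    show "inj_on ?F (carrier (Sigma_group n))"
    proof (rule inj_onI)
      fix \<sigma> \<tau> assume st: "\<sigma> \<in> carrier (Sigma_group n)" "\<tau> \<in> carrier (Sigma_group n)" and "?F \<sigma> = ?F \<tau>"
      from fun_cong[OF this(3), of a] have "Sigma_act n \<sigma> a = Sigma_act n \<tau> a" using a by simp
      then show "\<sigma> = \<tau>" by (rule Sigma_act_free[OF st a])
    qed
  next
    fix f assume "f \<in> ?F ` carrier (Sigma_group n)"
    then show "f \<in> carrier (deck_group ?c pi_map)" using Sigma_act_deck by blast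
  next
    fix f assume "f \<in> carrier (deck_group ?c pi_map)"
    then show "f \<in> ?F ` carrier (Sigma_group n)" using deck_eq_Sigma_act by blast
  qed
qed

text \<open>Deck transformations are defined as homeomorphisms. Holomorphy of the action together
  with surjectivity of the isomorphism shows that all of them are analytic.\<close>

theorem proposition4p14:
  fixes n :: nat
  assumes "n \<ge> 1"
  shows "analytic_covering (eig_index n <+> mat_index n) (mat_index n)
           (M_Omega_e n) pi_map (M_Omega n)
       \<and> (\<forall>\<sigma>\<in>carrier (Sigma_group n).
            holo_map (eig_index n <+> mat_index n) (eig_index n <+> mat_index n)
              (M_Omega_e n) (M_Omega_e n) (Sigma_act n \<sigma>))
       \<and> (\<lambda>\<sigma>. restrict (Sigma_act n \<sigma>) (M_Omega_e n))
            \<in> iso (Sigma_group n) (deck_group (M_Omega_e n) pi_map)"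
  using analytic_covering_pi_map holo_map_Sigma_act Sigma_act_iso_deck by blast

end
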